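(* Let $n\ge k\ge1$ be integers. For any partition type $\lambda$, the triple statistics $$(\mathrm{MAK}+\mathrm{bMaj},\ \mathrm{MAK}'+\mathrm{bMaj},\ \mathrm{cmajLSB})\quad\text{and}\quad(\mathrm{MAK}+\mathrm{bInv},\ \mathrm{MAK}'+\mathrm{bInv},\ \mathrm{cinvLSB})$$ are equidistributed on $\mathcal{OP}_n^k(\lambda)$.
   Context: $[n]=\{1,\dots,n\}$. An ordered partition of $[n]$ into $k$ blocks is a sequence $\pi=B_1/B_2/\cdots/B_k$ of disjoint nonempty subsets (blocks) of $[n]$ whose union is $[n]$; $\mathcal{OP}_n^k$ is the set of all of them. The opener (resp. closer) of a block is its least (resp. greatest) element; $\mathrm{open}(\pi)$ and $\mathrm{clos}(\pi)$ are the sets of openers and closers of the blocks of $\pi$. Type: $\mathcal S(\pi)$ is the set of elements of singleton blocks (singletons), $\mathcal O(\pi)$ the set of smallest elements of non-singleton blocks (strict openers), $\mathcal C(\pi)$ the set of largest elements of non-singleton blocks (strict closers), $\mathcal T(\pi)$ the set of all other elements (transients). The type of $\pi$ is $\lambda(\pi)=(\mathcal O(\pi),\mathcal C(\pi),\mathcal S(\pi),\mathcal T(\pi))$, and $\mathcal{OP}_n^k(\lambda)$ is the set of $\pi\in\mathcal{OP}_n^k$ with $\lambda(\pi)=\lambda$. For $i\in[n]$ let $w_i$ be the index (position, counted from left to right) of the block of $\pi$ containing $i$. Define $\mathrm{ros}(\pi)=\sum_{i=1}^n\#\{j\in\mathrm{open}(\pi): j<i,\ w_j>w_i\}$, $\mathrm{lcs}(\pi)=\sum_{i=1}^n\#\{j\in\mathrm{clos}(\pi):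 j<i,\ w_j<w_i\}$, $\mathrm{lob}(\pi)=\sum_{i=1}^n\#\{j\in\mathrm{open}(\pi): j>i,\ w_j<w_i\}$, $\mathrm{rcb}(\pi)=\sum_{i=1}^n\#\{j\in\mathrm{clos}(\pi): j>i,\ w_j>w_i\}$, and $\mathrm{lsb}(\pi)=\sum_{i=1}^n\mathrm{lsb}_i(\pi)$, where $\mathrm{lsb}_i(\pi)$ is the number of blocks to the left of the block containing $i$ whose opener is smaller than $i$ and whose closer is greater than $i$. Put $\mathrm{MAK}=\mathrm{ros}+\mathrm{lcs}$ and $\mathrm{MAK}'=\mathrm{lob}+\mathrm{rcb}$. For $\pi=B_1/\cdots/B_k$ write $B_i\succ B_j$ if $\min B_i>\max B_j$. $\mathrm{bInv}(\pi)$ is the number of pairs $i<j$ with $B_i\succ B_j$. A block descent is an integer $i$ with $B_i\succ B_{i+1}$, and $\mathrm{bMaj}(\pi)$ is the sum of the block descents of $\pi$. Put $\mathrm{cbInv}=\binom k2-\mathrm{bInv}$, $\mathrm{cbMaj}=\binom k2-\mathrm{bMaj}$, $\mathrm{cinvLSB}=\mathrm{lsb}+\mathrm{cbInv}+\binom k2$, $\mathrm{cmajLSB}=\mathrm{lsb}+\mathrm{cbMaj}+\binom k2$. Two tuples of statistics are equidistributed on a finite set if they have the same joint distribution on it. *)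

theory Defs
  imports "HOL-Library.Disjoint_Sets"
begin

text \<open>
  An ordered partition \<open>B\<^sub>1/\<dots>/B\<^sub>k\<close> is the list of its blocks; list positions
  start at 0, so \<open>B\<^sub>i\<close> is \<open>\<pi> ! (i - 1)\<close>.
\<close>

definition ordered_partitions :: "nat \<Rightarrow> nat \<Rightarrow> nat set list set" where
  "ordered_partitions n k =
    {\<pi>. length \<pi> = k \<and> distinct \<pi> \<and> partition_on {1..n} (set \<pi>)}"

lemma finite_ordered_partitions: "finite (ordered_partitions n k)"
proof (rule finite_subset)
  show "ordered_partitions n k \<subseteq> {\<pi>. set \<pi> \<subseteq> Pow {1..n} \<and> length \<pi> = k}"
    by (auto simp: ordered_partitions_def partition_on_def)
  show "finite {\<pi>. set \<pi> \<subseteq> Pow {1..n} \<and> length \<pi> = k}"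
    by (rule finite_lists_length_eq) simp
qed

text \<open>The underlying set \<open>[n]\<close> of an ordered partition.\<close>

definition ground :: "nat set list \<Rightarrow> nat set" where
  "ground \<pi> = \<Union> (set \<pi>)"

definition openers :: "nat set list \<Rightarrow> nat set" where
  "openers \<pi> = Min ` set \<pi>"

definition closers :: "nat set list \<Rightarrow> nat set" where
  "closers \<pi> = Max ` set \<pi>"

definition singletons :: "nat set list \<Rightarrow> nat set" where
  "singletons \<pi> = \<Union> {B \<in> set \<pi>. card B = 1}"

definition strict_openers :: "nat set list \<Rightarrow> nat set" where
  "strict_openers \<pi> = Min ` {B \<in> set \<pi>. card B \<noteq> 1}"

definition strict_closers :: "nat set list \<Rightarrow> nat set" where
  "strict_closers \<pi> = Max ` {B \<in> set \<pi>. card B \<noteq> 1}"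

definition transients :: "nat set list \<Rightarrow> nat set" where
  "transients \<pi> = ground \<pi> - (strict_openers \<pi> \<union> strict_closers \<pi> \<union> singletons \<pi>)"

type_synonym ptype = "nat set \<times> nat set \<times> nat set \<times> nat set"

definition partition_type :: "nat set list \<Rightarrow> ptype" where
  "partition_type \<pi> =
    (strict_openers \<pi>, strict_closers \<pi>, singletons \<pi>, transients \<pi>)"

definition ordered_partitions_of_type :: "nat \<Rightarrow> nat \<Rightarrow> ptype \<Rightarrow> nat set list set" where
  "ordered_partitions_of_type n k t =
    {\<pi> \<in> ordered_partitions n k. partition_type \<pi> = t}"

text \<open>The 1-based position \<open>w\<^sub>i\<close> of the block containing \<open>i\<close>.\<close>

definition block_index :: "nat set list \<Rightarrow> nat \<Rightarrow> nat" where
  "block_index \<pi> i = (THE p. p \<in> {1..length \<pi>} \<and> i \<in> \<pi> ! (p - 1))"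

definition ros :: "nat set list \<Rightarrow> nat" where
  "ros \<pi> = (\<Sum>i\<in>ground \<pi>.
    card {j \<in> openers \<pi>. j < i \<and> block_index \<pi> j > block_index \<pi> i})"

definition lcs :: "nat set list \<Rightarrow> nat" where
  "lcs \<pi> = (\<Sum>i\<in>ground \<pi>.
    card {j \<in> closers \<pi>. j < i \<and> block_index \<pi> j < block_index \<pi> i})"

definition lob :: "nat set list \<Rightarrow> nat" where
  "lob \<pi> = (\<Sum>i\<in>ground \<pi>.
    card {j \<in> openers \<pi>. j > i \<and> block_index \<pi> j < block_index \<pi> i})"

definition rcb :: "nat set list \<Rightarrow> nat" where
  "rcb \<pi> = (\<Sum>i\<in>ground \<pi>.
    card {j \<in> closers \<pi>. j > i \<and> block_index \<pi> j > block_index \<pi> i})"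

definition lsb :: "nat set list \<Rightarrow> nat" where
  "lsb \<pi> = (\<Sum>i\<in>ground \<pi>.
    card {p \<in> {1..length \<pi>}. p < block_index \<pi> i \<and>
      Min (\<pi> ! (p - 1)) < i \<and> i < Max (\<pi> ! (p - 1))})"

definition MAK :: "nat set list \<Rightarrow> nat" where
  "MAK \<pi> = ros \<pi> + lcs \<pi>"

definition MAK' :: "nat set list \<Rightarrow> nat" where
  "MAK' \<pi> = lob \<pi> + rcb \<pi>"

definition block_gt :: "nat set \<Rightarrow> nat set \<Rightarrow> bool" where
  "block_gt B C \<longleftrightarrow> Min B > Max C"

definition bInv :: "nat set list \<Rightarrow> nat" where
  "bInv \<pi> = card {(i, j). 1 \<le> i \<and> i < j \<and> j \<le> length \<pi> \<and>
    block_gt (\<pi> ! (i - 1)) (\<pi> ! (j - 1))}"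

definition block_descents :: "nat set list \<Rightarrow> nat set" where
  "block_descents \<pi> =
    {i. 1 \<le> i \<and> i < length \<pi> \<and> block_gt (\<pi> ! (i - 1)) (\<pi> ! i)}"

definition bMaj :: "nat set list \<Rightarrow> nat" where
  "bMaj \<pi> = \<Sum> (block_descents \<pi>)"

text \<open>Integer-valued, so that the subtraction is not truncated.\<close>

definition cbInv :: "nat set list \<Rightarrow> int" where
  "cbInv \<pi> = int (length \<pi> choose 2) - int (bInv \<pi>)"

definition cbMaj :: "nat set list \<Rightarrow> int" where
  "cbMaj \<pi> = int (length \<pi> choose 2) - int (bMaj \<pi>)"

definition cinvLSB :: "nat set list \<Rightarrow> int" where
  "cinvLSB \<pi> = int (lsb \<pi>) + cbInv \<pi> + int (length \<pi> choose 2)"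

definition cmajLSB :: "nat set list \<Rightarrow> int" where
  "cmajLSB \<pi> = int (lsb \<pi>) + cbMaj \<pi> + int (length \<pi> choose 2)"

text \<open>Meant for finite \<open>A\<close>; tuples of statistics are tuple-valued functions.\<close>

definition equidistributed_on :: "'a set \<Rightarrow> ('a \<Rightarrow> 'b) \<Rightarrow> ('a \<Rightarrow> 'b) \<Rightarrow> bool" where
  "equidistributed_on A f g \<longleftrightarrow>
    (\<forall>v. card {x \<in> A. f x = v} = card {x \<in> A. g x = v})"

end

theory Submission
  imports Defs
begin

text \<open>
  Call a block active at \<open>i\<close> if its opener is smaller and its closer greater than \<open>i\<close>, and let
  \<open>rsb\<close> be the mirror image of \<open>lsb\<close>: it sums, over all \<open>i\<close>, the number of blocks to the right
  of the block of \<open>i\<close> that are active at \<open>i\<close>.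

  The first observation is that, up to constants depending only on the sets of openers and closers,
  all the statistics reduce to \<open>rsb\<close>. The blocks closed before \<open>i\<close> are counted by \<open>lcs\<close> if they
  lie to the left and by \<open>ros\<close> if they lie to the right, and what remains in \<open>ros\<close> are the
  active blocks to the right; hence \<open>MAK\<close> is a constant plus \<open>rsb\<close>. The same holds for \<open>MAK'\<close>
  with the blocks opened after \<open>i\<close>, and \<open>lsb + rsb\<close> is constant because the number of blocks
  other than that of \<open>i\<close> that are active at \<open>i\<close> is (\<open>MAK_MAK'_lsb_conv_rsb\<close>). Both triples are
  therefore the same function of a single statistic, \<open>rsb + bMaj\<close> and \<open>rsb + bInv\<close> respectively,
  and it is enough to have a bijection of the partitions of the given type that carries one into the other.

  Such a bijection is built by inserting the elements \<open>1, 2, \<dots>\<close> one after the other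
  (\<open>states_bijection\<close>). An element that is not an opener joins one of the active blocks; this
  changes neither \<open>bMaj\<close> nor \<open>bInv\<close>, and increases \<open>rsb\<close> by the number of active blocks to the
  right of the chosen one. These increments are \<open>0, \<dots>, l - 1\<close>, each occurring once, where \<open>l\<close> is
  the number of active blocks. An opener creates a new block in one of the \<open>m + 1\<close> gaps between the
  \<open>m\<close> existing blocks. The new block is \<open>\<succ>\<close> exactly the complete ones, and the active ones
  to its right contribute to \<open>rsb\<close>, so \<open>rsb + bInv\<close> grows by the number of blocks to the
  right of the gap (\<open>rsb_bInv_gap_insert\<close>). The growth of \<open>rsb + bMaj\<close> is more
  irregular (\<open>rsb_bMaj_gap_insert\<close>), but over all gaps it again takes each of the values
  \<open>0, \<dots>, m\<close> once (\<open>bij_betw_gap_weight\<close>), as in the classical insertion proof that the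
  major index is Mahonian. Since \<open>l\<close> and \<open>m\<close> depend only on the type, choices with equal
  increments can be matched at every step (\<open>lift_bijection\<close>).
\<close>

section \<open>Sums over ordered pairs of list entries\<close>

text \<open>
  The sum of \<open>w x y\<close> over all pairs of entries with \<open>x\<close> at an earlier position than \<open>y\<close>.
\<close>

fun pair_sum :: "('a \<Rightarrow> 'a \<Rightarrow> nat) \<Rightarrow> 'a list \<Rightarrow> nat" where
  "pair_sum w [] = 0"
| "pair_sum w (x # xs) = (\<Sum>y\<leftarrow>xs. w x y) + pair_sum w xs"

lemma pair_sum_append:
  "pair_sum w (xs @ ys) = pair_sum w xs + pair_sum w ys + (\<Sum>x\<leftarrow>xs. \<Sum>y\<leftarrow>ys. w x y)"
  by (induction xs) auto

lemma pair_sum_insert: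
  "pair_sum w (ys @ x # zs) =
    pair_sum w (ys @ zs) + (\<Sum>y\<leftarrow>ys. w y x) + (\<Sum>z\<leftarrow>zs. w x z)"
  by (simp add: pair_sum_append sum_list_addf)

lemma pair_sum_add: "pair_sum (\<lambda>x y. v x y + w x y) xs = pair_sum v xs + pair_sum w xs"
  by (induction xs) (simp_all add: sum_list_addf)

lemma pair_sum_nth:
  "pair_sum w xs = (\<Sum>p<length xs. \<Sum>q\<in>{p<..<length xs}. w (xs ! p) (xs ! q))"
proof (induction xs)
  case (Cons x xs)
  have "(\<Sum>q\<in>{Suc p<..<Suc (length xs)}. w (xs ! p) ((x # xs) ! q)) =
      (\<Sum>q\<in>{p<..<length xs}. w (xs ! p) (xs ! q))" for p
    by (rule sum.reindex_bij_witness[of _ Suc "\<lambda>q. q - 1"]) auto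
  moreover have "(\<Sum>q\<in>{0<..<Suc (length xs)}. w x ((x # xs) ! q)) = (\<Sum>q<length xs. w x (xs ! q))"
    by (rule sum.reindex_bij_witness[of _ Suc "\<lambda>q. q - 1"]) auto
  ultimately show ?case
    using Cons by (simp add: sum.lessThan_Suc_shift sum_list_sum_nth atLeast0LessThan del: sum.lessThan_Suc)
qed simp

lemma sum_list_of_bool_drop:
  "(\<Sum>x\<leftarrow>drop p xs. of_bool (R x)) = card {q. p \<le> q \<and> q < length xs \<and> R (xs ! q)}"
proof -
  have len: "(\<Sum>x\<leftarrow>ys. of_bool (R x)) = length (filter R ys)" for ys
    by (induction ys) auto
  have "(\<Sum>x\<leftarrow>drop p xs. of_bool (R x)) = length (filter R (drop p xs))"
    by (rule len)
  also have "\<dots> = card {q. q < length xs - p \<and> R (drop p xs ! q)}"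
    by (simp add: length_filter_conv_card)
  also have "\<dots> = card {q. p \<le> q \<and> q < length xs \<and> R (xs ! q)}"
    by (rule bij_betw_same_card[of "\<lambda>q. p + q"],
        rule bij_betw_byWitness[where f' = "\<lambda>q. q - p"]) auto
  finally show ?thesis .
qed

section \<open>Reduction of the statistics to crossings\<close>

text \<open>
  The number of elements of \<open>B\<close> at which \<open>C\<close> is active, that is, strictly between the opener and the
  closer of \<open>C\<close>.
\<close>

definition crossings :: "nat set \<Rightarrow> nat set \<Rightarrow> nat" where
  "crossings B C = card {i \<in> B. Min C < i \<and> i < Max C}"

text \<open>
  The mirror image of \<^const>\<open>lsb\<close>, written as a sum over pairs of blocks.
\<close>

definition rsb :: "nat set list \<Rightarrow> nat" where
  "rsb = pair_sum crossings"

lemma bInv_eq_pair_sum: "bInv \<pi> = pair_sum (\<lambda>B C. of_bool (block_gt B C)) \<pi>"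
proof -
  let ?S = "SIGMA p:{..<length \<pi>}. {q \<in> {p<..<length \<pi>}. block_gt (\<pi> ! p) (\<pi> ! q)}"
  have "bInv \<pi> = card ?S"
    unfolding bInv_def
    by (rule bij_betw_same_card[of "\<lambda>(i, j). (i - 1, j - 1)"],
        rule bij_betw_byWitness[where f' = "\<lambda>(p, q). (Suc p, Suc q)"]) auto
  also have "\<dots> = (\<Sum>p<length \<pi>. card {q \<in> {p<..<length \<pi>}. block_gt (\<pi> ! p) (\<pi> ! q)})"
    by simp
  also have "\<dots> = pair_sum (\<lambda>B C. of_bool (block_gt B C)) \<pi>"
    unfolding pair_sum_nth by (intro sum.cong refl) (simp add: Int_def)
  finally show ?thesis .
qed

lemma ordered_partition_blocks:
  assumes \<pi>: "\<pi> \<in> ordered_partitions n k"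
  shows "length \<pi> = k" "distinct \<pi>" "\<Union> (set \<pi>) = {1..n}"
    "\<And>B. B \<in> set \<pi> \<Longrightarrow> finite B" "\<And>B. B \<in> set \<pi> \<Longrightarrow> B \<noteq> {}"
    "\<And>B C i. B \<in> set \<pi> \<Longrightarrow> C \<in> set \<pi> \<Longrightarrow> i \<in> B \<Longrightarrow> i \<in> C \<Longrightarrow> B = C"
proof -
  show "length \<pi> = k" "distinct \<pi>" using \<pi> by (auto simp: ordered_partitions_def)
  have p: "partition_on {1..n} (set \<pi>)" using \<pi> by (simp add: ordered_partitions_def)
  show U: "\<Union> (set \<pi>) = {1..n}" using p by (simp add: partition_on_def)
  show "finite B" if "B \<in> set \<pi>" for B
    using that U by (metis Union_upper finite_atLeastAtMost finite_subset)
  show "B \<noteq> {}" if "B \<in> set \<pi>" for B using p that by (auto simp: partition_on_def)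
  show "B = C" if "B \<in> set \<pi>" "C \<in> set \<pi>" "i \<in> B" "i \<in> C" for B C i
    using p that by (auto simp: partition_on_def disjoint_def)
qed

lemma block_index_eq:
  assumes \<pi>: "\<pi> \<in> ordered_partitions n k" and p: "p < k" "i \<in> \<pi> ! p"
  shows "block_index \<pi> i = Suc p"
proof -
  note b = ordered_partition_blocks[OF \<pi>]
  show ?thesis
    unfolding block_index_def
  proof (rule the_equality)
    show "Suc p \<in> {1..length \<pi>} \<and> i \<in> \<pi> ! (Suc p - 1)" using p b(1) by simp
    fix q assume q: "q \<in> {1..length \<pi>} \<and> i \<in> \<pi> ! (q - 1)"
    then have "\<pi> ! (q - 1) \<in> set \<pi>" using b(1) by (intro nth_mem) auto
    then have "\<pi> ! (q - 1) = \<pi> ! p" using q p b(1) b(6)[of "\<pi> ! (q - 1)" "\<pi> ! p" i] by simp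
    moreover have "q - 1 < length \<pi>" "p < length \<pi>" using q p b(1) by auto
    ultimately have "q - 1 = p" using b(2) by (simp add: nth_eq_iff_index_eq)
    with q show "q = Suc p" by auto
  qed
qed

lemma card_openers_closers_conv:
  assumes \<pi>: "\<pi> \<in> ordered_partitions n k"
  shows "card {j \<in> openers \<pi>. R j (block_index \<pi> j)} = (\<Sum>q<k. of_bool (R (Min (\<pi> ! q)) (Suc q)))"
    "card {j \<in> closers \<pi>. R j (block_index \<pi> j)} = (\<Sum>q<k. of_bool (R (Max (\<pi> ! q)) (Suc q)))"
proof -
  note b = ordered_partition_blocks[OF \<pi>]
  have *: "card {j \<in> F ` set \<pi>. R j (block_index \<pi> j)} = (\<Sum>q<k. of_bool (R (F (\<pi> ! q)) (Suc q)))"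
    if F: "\<And>B. B \<in> set \<pi> \<Longrightarrow> F B \<in> B" for F
  proof -
    have w: "block_index \<pi> (F (\<pi> ! q)) = Suc q" if "q < k" for q
      using block_index_eq[OF \<pi> that] F that b(1) by simp
    have "{j \<in> F ` set \<pi>. R j (block_index \<pi> j)} = (\<lambda>q. F (\<pi> ! q)) ` {q. q < k \<and> R (F (\<pi> ! q)) (Suc q)}"
      using w by (auto simp: b(1)[symmetric] set_conv_nth)
    moreover have "inj_on (\<lambda>q. F (\<pi> ! q)) {q. q < k \<and> R (F (\<pi> ! q)) (Suc q)}"
      using w by (intro inj_onI) (metis (mono_tags, lifting) mem_Collect_eq nat.inject)
    ultimately show ?thesis by (simp add: card_image lessThan_def Collect_conj_eq[symmetric] Int_def)
  qed
  show "card {j \<in> openers \<pi>. R j (block_index \<pi> j)} = (\<Sum>q<k. of_bool (R (Min (\<pi> ! q)) (Suc q)))"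
    unfolding openers_def using b(4,5) by (intro *) simp
  show "card {j \<in> closers \<pi>. R j (block_index \<pi> j)} = (\<Sum>q<k. of_bool (R (Max (\<pi> ! q)) (Suc q)))"
    unfolding closers_def using b(4,5) by (intro *) simp
qed

lemma rsb_sum_ground:
  assumes \<pi>: "\<pi> \<in> ordered_partitions n k"
  shows "rsb \<pi> = (\<Sum>i\<in>{1..n}. \<Sum>q<k. of_bool (block_index \<pi> i < Suc q \<and> Min (\<pi> ! q) < i \<and> i < Max (\<pi> ! q)))"
proof -
  note b = ordered_partition_blocks[OF \<pi>]
  have fin: "finite (\<pi> ! p)" if "p < k" for p using b(1,4) that by simp
  let ?r = "\<lambda>i. \<Sum>q<k. of_bool (block_index \<pi> i < Suc q \<and> Min (\<pi> ! q) < i \<and> i < Max (\<pi> ! q)) :: nat"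
  have "(\<Union>p<k. \<pi> ! p) = {1..n}"
    using b(3) unfolding b(1)[symmetric] by (auto simp: set_conv_nth)
  moreover have "(\<Sum>i\<in>(\<Union>p<k. \<pi> ! p). ?r i) = (\<Sum>p<k. \<Sum>i\<in>\<pi> ! p. ?r i)"
  proof (rule sum.UNION_disjoint)
    have "\<pi> ! p = \<pi> ! q \<longleftrightarrow> p = q" if "p < k" "q < k" for p q
      using that b(1,2) by (simp add: nth_eq_iff_index_eq)
    then show "\<forall>p\<in>{..<k}. \<forall>q\<in>{..<k}. p \<noteq> q \<longrightarrow> \<pi> ! p \<inter> \<pi> ! q = {}"
      using b(1,6) by (metis disjoint_iff lessThan_iff nth_mem)
  qed (use fin in auto)
  moreover have "(\<Sum>i\<in>\<pi> ! p. ?r i) = (\<Sum>q\<in>{p<..<k}. crossings (\<pi> ! p) (\<pi> ! q))" if p: "p < k" for p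
  proof -
    have "(\<Sum>i\<in>\<pi> ! p. ?r i) =
        (\<Sum>i\<in>\<pi> ! p. \<Sum>q<k. of_bool (p < q \<and> Min (\<pi> ! q) < i \<and> i < Max (\<pi> ! q)))"
      using block_index_eq[OF \<pi> p] by (intro sum.cong refl) simp
    also have "\<dots> = (\<Sum>q<k. \<Sum>i\<in>\<pi> ! p. of_bool (p < q \<and> Min (\<pi> ! q) < i \<and> i < Max (\<pi> ! q)))"
      by (rule sum.swap)
    also have "\<dots> = (\<Sum>q<k. if p < q then crossings (\<pi> ! p) (\<pi> ! q) else 0)"
      using fin[OF p] by (intro sum.cong refl) (auto simp: crossings_def Int_def)
    also have "\<dots> = (\<Sum>q\<in>{p<..<k}. crossings (\<pi> ! p) (\<pi> ! q))"
      by (subst sum.inter_filter[symmetric]) (auto intro!: sum.cong)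
    finally show ?thesis .
  qed
  ultimately show ?thesis
    unfolding rsb_def pair_sum_nth b(1) by simp
qed

lemma MAK_MAK'_lsb_conv_rsb:
  assumes \<pi>: "\<pi> \<in> ordered_partitions n k"
  shows "MAK \<pi> = (\<Sum>i=1..n. card {j \<in> closers \<pi>. j < i}) + rsb \<pi>"
    and "MAK' \<pi> = (\<Sum>i=1..n. card {j \<in> openers \<pi>. i < j}) + rsb \<pi>"
    and "lsb \<pi> + rsb \<pi> + (\<Sum>i=1..n. card {j \<in> closers \<pi>. j < i}) + n =
      (\<Sum>i=1..n. card {j \<in> openers \<pi>. j \<le> i})"
proof -
  note b = ordered_partition_blocks[OF \<pi>]
  note conv = card_openers_closers_conv[OF \<pi>]
  have ground: "ground \<pi> = {1..n}" using b(3) by (simp add: ground_def)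
  have min_max: "Min (\<pi> ! q) \<le> Max (\<pi> ! q)" if "q < k" for q
    using b(1,4,5) that by simp
  \<comment> \<open>In its own block \<open>i\<close> lies weakly between opener and closer; it is neither opener nor closer of any
    other block. Each identity below is then checked block by block.\<close>
  have index: "\<exists>p<k. block_index \<pi> i = Suc p \<and> Min (\<pi> ! p) \<le> i \<and> i \<le> Max (\<pi> ! p) \<and>
      (\<forall>q<k. q \<noteq> p \<longrightarrow> i \<noteq> Min (\<pi> ! q) \<and> i \<noteq> Max (\<pi> ! q))" if i: "i \<in> {1..n}" for i
  proof -
    obtain p where p: "p < k" "i \<in> \<pi> ! p"
      using i unfolding b(3)[symmetric] b(1)[symmetric] by (auto simp: in_set_conv_nth)
    have "i \<noteq> Min (\<pi> ! q) \<and> i \<noteq> Max (\<pi> ! q)" if q: "q < k" "q \<noteq> p" for q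
    proof -
      have "i \<notin> \<pi> ! q"
        using block_index_eq[OF \<pi> q(1), of i] block_index_eq[OF \<pi> p] q(2) by auto
      moreover have "\<pi> ! q \<in> set \<pi>" using q(1) b(1) by simp
      ultimately show ?thesis using b(4,5) by (metis Max_in Min_in)
    qed
    moreover have "finite (\<pi> ! p)" using b(1,4) p(1) by simp
    ultimately show ?thesis using p block_index_eq[OF \<pi> p] by (intro exI[of _ p]) auto
  qed
  show "MAK \<pi> = (\<Sum>i=1..n. card {j \<in> closers \<pi>. j < i}) + rsb \<pi>"
    unfolding MAK_def ros_def lcs_def ground rsb_sum_ground[OF \<pi>] sum.distrib[symmetric]
      conv(1)[where R = "\<lambda>j w. j < _ \<and> w > _"] conv(2)[where R = "\<lambda>j w. j < _ \<and> w < _"]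
      conv(2)[where R = "\<lambda>j w. j < _"]
  proof (intro sum.cong refl)
    fix i q assume "i \<in> {1..n}" and q: "q \<in> {..<k}"
    with index obtain p where "block_index \<pi> i = Suc p" "Min (\<pi> ! p) \<le> i" "i \<le> Max (\<pi> ! p)"
      "q \<noteq> p \<Longrightarrow> i \<noteq> Min (\<pi> ! q) \<and> i \<noteq> Max (\<pi> ! q)"
      by (metis lessThan_iff)
    then show "of_bool (Min (\<pi> ! q) < i \<and> block_index \<pi> i < Suc q) +
        of_bool (Max (\<pi> ! q) < i \<and> Suc q < block_index \<pi> i) =
        (of_bool (Max (\<pi> ! q) < i) + of_bool (block_index \<pi> i < Suc q \<and> Min (\<pi> ! q) < i \<and> i < Max (\<pi> ! q)) :: nat)"
      using min_max[of q] q by (cases q p rule: linorder_cases) auto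
  qed
  show "MAK' \<pi> = (\<Sum>i=1..n. card {j \<in> openers \<pi>. i < j}) + rsb \<pi>"
    unfolding MAK'_def lob_def rcb_def ground rsb_sum_ground[OF \<pi>] sum.distrib[symmetric]
      conv(1)[where R = "\<lambda>j w. j > _ \<and> w < _"] conv(2)[where R = "\<lambda>j w. j > _ \<and> w > _"]
      conv(1)[where R = "\<lambda>j w. j > _"]
  proof (intro sum.cong refl)
    fix i q assume "i \<in> {1..n}" and q: "q \<in> {..<k}"
    with index obtain p where "block_index \<pi> i = Suc p" "Min (\<pi> ! p) \<le> i" "i \<le> Max (\<pi> ! p)"
      "q \<noteq> p \<Longrightarrow> i \<noteq> Min (\<pi> ! q) \<and> i \<noteq> Max (\<pi> ! q)"
      by (metis lessThan_iff)
    then show "of_bool (i < Min (\<pi> ! q) \<and> Suc q < block_index \<pi> i) +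
        of_bool (i < Max (\<pi> ! q) \<and> block_index \<pi> i < Suc q) =
        (of_bool (i < Min (\<pi> ! q)) + of_bool (block_index \<pi> i < Suc q \<and> Min (\<pi> ! q) < i \<and> i < Max (\<pi> ! q)) :: nat)"
      using min_max[of q] q by (cases q p rule: linorder_cases) auto
  qed
  have lsb_i: "card {p \<in> {1..length \<pi>}. p < w \<and> Min (\<pi> ! (p - 1)) < i \<and> i < Max (\<pi> ! (p - 1))} =
      (\<Sum>q<k. of_bool (Suc q < w \<and> Min (\<pi> ! q) < i \<and> i < Max (\<pi> ! q)))" for i w
  proof -
    have "card {p \<in> {1..length \<pi>}. p < w \<and> Min (\<pi> ! (p - 1)) < i \<and> i < Max (\<pi> ! (p - 1))} =
        card {q \<in> {..<k}. Suc q < w \<and> Min (\<pi> ! q) < i \<and> i < Max (\<pi> ! q)}"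
      by (rule bij_betw_same_card[of "\<lambda>p. p - 1"], rule bij_betw_byWitness[where f' = Suc])
        (auto simp: b(1))
    then show ?thesis by (simp add: Int_def)
  qed
  have own: "(\<Sum>i=1..n. \<Sum>q<k. of_bool (block_index \<pi> i = Suc q)) = n"
  proof -
    have "(\<Sum>q<k. of_bool (block_index \<pi> i = Suc q)) = (1::nat)" if "i \<in> {1..n}" for i
      using index[OF that] by auto
    then show ?thesis by simp
  qed
  have "lsb \<pi> + rsb \<pi> + (\<Sum>i=1..n. card {j \<in> closers \<pi>. j < i}) +
        (\<Sum>i=1..n. \<Sum>q<k. of_bool (block_index \<pi> i = Suc q)) =
      (\<Sum>i=1..n. card {j \<in> openers \<pi>. j \<le> i})"
    unfolding lsb_def ground lsb_i rsb_sum_ground[OF \<pi>] sum.distrib[symmetric]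
      conv(1)[where R = "\<lambda>j w. j \<le> _"] conv(2)[where R = "\<lambda>j w. j < _"]
  proof (intro sum.cong refl)
    fix i q assume "i \<in> {1..n}" and q: "q \<in> {..<k}"
    with index obtain p where "block_index \<pi> i = Suc p" "Min (\<pi> ! p) \<le> i" "i \<le> Max (\<pi> ! p)"
      "q \<noteq> p \<Longrightarrow> i \<noteq> Min (\<pi> ! q) \<and> i \<noteq> Max (\<pi> ! q)"
      by (metis lessThan_iff)
    then show "of_bool (Suc q < block_index \<pi> i \<and> Min (\<pi> ! q) < i \<and> i < Max (\<pi> ! q)) +
        of_bool (block_index \<pi> i < Suc q \<and> Min (\<pi> ! q) < i \<and> i < Max (\<pi> ! q)) +
        of_bool (Max (\<pi> ! q) < i) + of_bool (block_index \<pi> i = Suc q) =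
        (of_bool (Min (\<pi> ! q) \<le> i) :: nat)"
      using min_max[of q] q by (cases q p rule: linorder_cases) auto
  qed
  then show "lsb \<pi> + rsb \<pi> + (\<Sum>i=1..n. card {j \<in> closers \<pi>. j < i}) + n =
      (\<Sum>i=1..n. card {j \<in> openers \<pi>. j \<le> i})"
    unfolding own .
qed

section \<open>Increment maps and matching of choices\<close>

lemma bij_betw_count_after:
  fixes S :: "nat set"
  assumes "finite S"
  shows "bij_betw (\<lambda>p. card {q \<in> S. p < q}) S {..<card S}"
proof -
  have less: "card {q \<in> S. p' < q} < card {q \<in> S. p < q}" if "p < p'" "p' \<in> S" for p p'
    using that assms by (intro psubset_card_mono) auto
  have inj: "inj_on (\<lambda>p. card {q \<in> S. p < q}) S"
    by (rule linorder_inj_onI') (use less in force)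
  have "(\<lambda>p. card {q \<in> S. p < q}) ` S \<subseteq> {..<card S}"
    using assms by (auto intro!: psubset_card_mono)
  with inj show ?thesis
    by (simp add: bij_betw_def card_image card_subset_eq)
qed

text \<open>
  The increment of \<open>rsb + bMaj\<close> when a new block is put into gap \<open>p\<close> of a list of \<open>m\<close> blocks,
  with \<open>A\<close> the set of positions whose block is active or the right end of a descent. From right
  to left, the last gap and the gaps before a position in \<open>A\<close> get the values \<open>0, \<dots>, card A\<close>; the
  other gaps get, from left to right, the values above \<open>card A\<close>.
\<close>

lemma bij_betw_gap_weight:
  fixes m :: nat
  assumes A: "A \<subseteq> {..<m}"
  defines "f \<equiv> (\<lambda>p. card {q \<in> A. p \<le> q} + (if p < m \<and> p \<notin> A then Suc p else 0))"
  shows "bij_betw f {..<Suc m} {..<Suc m}"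
proof -
  have fin: "finite A" using A finite_subset by blast
  have split: "card A = card {q \<in> A. q < p} + card {q \<in> A. p \<le> q}" for p
    using fin by (subst card_Un_disjoint[symmetric]) (auto intro!: arg_cong[of _ _ card])
  have below: "card {q \<in> A. q < p} \<le> p" for p
    using card_mono[of "{..<p}" "{q \<in> A. q < p}"] by auto
  \<comment> \<open>Gaps in \<open>A\<close> and the last gap get the values up to \<open>card A\<close>, the other gaps the larger ones.\<close>
  have small: "f p \<le> card A" if "\<not> (p < m \<and> p \<notin> A)" for p
    using that split[of p] unfolding f_def by auto
  have large: "card A < f p" if "p < m \<and> p \<notin> A" for p
    using that split[of p] below[of p] unfolding f_def by auto
  have cardA: "card A \<le> m" using card_mono[OF _ A] by simp
  have range: "f ` {..<Suc m} \<subseteq> {..<Suc m}"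
  proof (clarsimp simp: less_Suc_eq_le)
    fix p assume "p \<le> m"
    show "f p \<le> m"
    proof (cases "p < m \<and> p \<notin> A")
      case True
      then have "{q \<in> A. p \<le> q} \<subseteq> {p<..<m}" using A by (auto simp: order.order_iff_strict)
      from card_mono[OF _ this] have "card {q \<in> A. p \<le> q} \<le> m - Suc p" by simp
      with True show ?thesis by (auto simp: f_def)
    qed (use small[of p] cardA in auto)
  qed
  have "inj_on f {..<Suc m}"
  proof (rule linorder_inj_onI')
    fix p p' assume pp: "p \<in> {..<Suc m}" "p' \<in> {..<Suc m}" "p < p'"
    consider "p \<in> A" "\<not> (p' < m \<and> p' \<notin> A)" | "p < m \<and> p \<notin> A" "\<not> (p' < m \<and> p' \<notin> A)"
      | "\<not> (p < m \<and> p \<notin> A)" "p' < m \<and> p' \<notin> A" | "p \<notin> A" "p' < m" "p' \<notin> A"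
      using pp by fastforce
    then show "f p \<noteq> f p'"
    proof cases
      case 1
      have "card {q \<in> A. p' \<le> q} < card {q \<in> A. p \<le> q}"
      proof (rule psubset_card_mono)
        have "p \<in> {q \<in> A. p \<le> q} - {q \<in> A. p' \<le> q}" using 1 pp by simp
        moreover have "{q \<in> A. p' \<le> q} \<subseteq> {q \<in> A. p \<le> q}" using pp by auto
        ultimately show "{q \<in> A. p' \<le> q} \<subset> {q \<in> A. p \<le> q}" by blast
      qed (use fin in simp)
      with 1 show ?thesis by (auto simp: f_def)
    next
      case 4
      have "{q \<in> A. p \<le> q} - {q \<in> A. p' \<le> q} \<subseteq> {p<..<p'}"
        using 4 by (auto simp: order.order_iff_strict)
      from card_mono[OF _ this] have "card {q \<in> A. p \<le> q} - card {q \<in> A. p' \<le> q} \<le> p' - Suc p"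
        using diff_card_le_card_Diff[of "{q \<in> A. p' \<le> q}" "{q \<in> A. p \<le> q}"] fin by simp
      with 4 pp show ?thesis by (simp add: f_def)
    qed (use small large in force)+
  qed
  with range show ?thesis
    by (simp add: bij_betw_def endo_inj_surj)
qed

text \<open>
  Let every object of \<open>A\<close> be extended to an object of \<open>A'\<close> by a choice, such that for each of two
  statistics the choices add \<open>0, \<dots>, b - 1\<close>, each once. Then a bijection of \<open>A\<close> that carries one
  statistic into the other lifts to \<open>A'\<close>.
\<close>

lemma lift_bijection:
  fixes f g :: "'a \<Rightarrow> nat" and f' g' :: "'b \<Rightarrow> nat"
  assumes \<sigma>: "bij_betw \<sigma> A A" and fg: "\<And>x. x \<in> A \<Longrightarrow> f x = g (\<sigma> x)"
    and h: "bij_betw h (Sigma A I) A'"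
    and a: "\<And>x. x \<in> A \<Longrightarrow> bij_betw (a x) (I x) {..<b}"
    and c: "\<And>x. x \<in> A \<Longrightarrow> bij_betw (c x) (I x) {..<b}"
    and f': "\<And>x p. x \<in> A \<Longrightarrow> p \<in> I x \<Longrightarrow> f' (h (x, p)) = f x + a x p"
    and g': "\<And>x p. x \<in> A \<Longrightarrow> p \<in> I x \<Longrightarrow> g' (h (x, p)) = g x + c x p"
  shows "\<exists>\<sigma>'. bij_betw \<sigma>' A' A' \<and> (\<forall>y\<in>A'. f' y = g' (\<sigma>' y))"
proof -
  \<comment> \<open>On top of \<open>\<sigma>\<close>, a choice is replaced by the one that adds the same amount to the other statistic.\<close>
  define \<tau> where "\<tau> = (\<lambda>(x, p). (\<sigma> x, inv_into (I (\<sigma> x)) (c (\<sigma> x)) (a x p)))"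
  have \<sigma>A: "\<sigma> x \<in> A" if "x \<in> A" for x using bij_betwE[OF \<sigma>] that by blast
  have \<tau>_fibre: "bij_betw (\<lambda>p. inv_into (I (\<sigma> x)) (c (\<sigma> x)) (a x p)) (I x) (I (\<sigma> x))" if "x \<in> A" for x
    using bij_betw_trans[OF a[OF that] bij_betw_inv_into[OF c[OF \<sigma>A[OF that]]]] by (simp add: comp_def)
  have "bij_betw \<tau> (Sigma A I) (Sigma A I)"
    unfolding bij_betw_def
  proof
    show "inj_on \<tau> (Sigma A I)"
    proof (rule inj_onI, clarify)
      fix x p y q assume "x \<in> A" "p \<in> I x" "y \<in> A" "q \<in> I y" and eq: "\<tau> (x, p) = \<tau> (y, q)"
      from eq have "\<sigma> x = \<sigma> y" by (simp add: \<tau>_def)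
      then have "x = y" using \<sigma> \<open>x \<in> A\<close> \<open>y \<in> A\<close> by (metis bij_betw_def inj_onD)
      moreover from this have "p = q"
        using eq \<tau>_fibre[OF \<open>x \<in> A\<close>] \<open>p \<in> I x\<close> \<open>q \<in> I y\<close> by (auto simp: \<tau>_def bij_betw_def dest: inj_onD)
      ultimately show "x = y \<and> p = q" by simp
    qed
    show "\<tau> ` Sigma A I = Sigma A I"
    proof
      show "\<tau> ` Sigma A I \<subseteq> Sigma A I"
        using \<sigma>A bij_betwE[OF \<tau>_fibre] by (auto simp: \<tau>_def)
      show "Sigma A I \<subseteq> \<tau> ` Sigma A I"
      proof clarify
        fix y q assume "y \<in> A" "q \<in> I y"
        then obtain x where x: "x \<in> A" "y = \<sigma> x" using \<sigma> by (auto simp: bij_betw_def)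
        with \<open>q \<in> I y\<close> obtain p where "p \<in> I x" "q = inv_into (I (\<sigma> x)) (c (\<sigma> x)) (a x p)"
          using \<tau>_fibre[OF x(1)] unfolding bij_betw_def by blast
        with x show "(y, q) \<in> \<tau> ` Sigma A I" by (force simp: \<tau>_def)
      qed
    qed
  qed
  then have "bij_betw (h \<circ> \<tau> \<circ> inv_into (Sigma A I) h) A' A'"
    using h by (meson bij_betw_inv_into bij_betw_trans)
  moreover have "f' y = g' ((h \<circ> \<tau> \<circ> inv_into (Sigma A I) h) y)" if "y \<in> A'" for y
  proof -
    have "y \<in> h ` Sigma A I" using h that by (simp add: bij_betw_def)
    then obtain x p where xp: "x \<in> A" "p \<in> I x" "y = h (x, p)" by auto
    have "inv_into (Sigma A I) h y = (x, p)"
      using h xp by (auto simp: bij_betw_def intro!: inv_into_f_f)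
    moreover have "c (\<sigma> x) (inv_into (I (\<sigma> x)) (c (\<sigma> x)) (a x p)) = a x p"
      using bij_betwE[OF a[OF xp(1)]] xp(2) c[OF \<sigma>A[OF xp(1)]]
      by (intro f_inv_into_f) (auto simp: bij_betw_def)
    moreover have "inv_into (I (\<sigma> x)) (c (\<sigma> x)) (a x p) \<in> I (\<sigma> x)"
      using bij_betwE[OF \<tau>_fibre[OF xp(1)]] xp(2) by blast
    ultimately show ?thesis
      using xp fg[OF xp(1)] f'[OF xp(1,2)] g'[OF \<sigma>A[OF xp(1)]] by (simp add: \<tau>_def)
  qed
  ultimately show ?thesis by blast
qed

section \<open>Partially built ordered partitions\<close>

text \<open>
  In a possibly incomplete block \<open>B\<close>, the only opener is the minimum, and the only closer is the
  maximum, provided that the block is complete. An active block contains a marker \<open>N\<close>, greater than all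
  elements inserted so far, as a substitute for the elements that are still missing; so none of its
  proper elements is its maximum.
\<close>

definition block_ok :: "nat set \<Rightarrow> nat set \<Rightarrow> nat \<Rightarrow> nat set \<Rightarrow> bool" where
  "block_ok P Q N B \<longleftrightarrow> B - {N} \<noteq> {} \<and>
    (\<forall>i\<in>B - {N}. (i \<in> P \<longleftrightarrow> (\<forall>j\<in>B. i \<le> j)) \<and> (i \<in> Q \<longleftrightarrow> (\<forall>j\<in>B. j \<le> i)))"

text \<open>
  A state describes what remains of an ordered partition with openers \<open>P\<close> and closers \<open>Q\<close> when all elements
  greater than \<open>m\<close> are deleted, blocks that become empty are dropped, and the marker is put into
  the remaining blocks that have lost elements. The marker is the only number that several blocks may
  share. It makes the maximum of an active block greater than all elements, so that \<^const>\<open>block_gt\<close>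
  and \<^const>\<open>crossings\<close> treat the block as one that is still to be closed.
\<close>

definition states :: "nat set \<Rightarrow> nat set \<Rightarrow> nat \<Rightarrow> nat \<Rightarrow> nat set list set" where
  "states P Q N m = {xs. sorted_wrt (\<lambda>B C. B \<inter> C \<subseteq> {N}) xs \<and> \<Union> (set xs) - {N} = {1..m} \<and>
    (\<forall>B\<in>set xs. block_ok P Q N B)}"

lemma states_block:
  assumes "xs \<in> states P Q N m" "m < N" "B \<in> set xs"
  shows "finite B" "B \<subseteq> insert N {1..m}" "B \<noteq> {}" "1 \<le> Min B" "Min B \<le> m"
    "N \<in> B \<Longrightarrow> Max B = N" "N \<notin> B \<Longrightarrow> Max B \<le> m"
proof -
  show sub: "B \<subseteq> insert N {1..m}" and "B \<noteq> {}"
    using assms by (auto simp: states_def block_ok_def)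
  then show fin: "finite B" using finite_subset by blast
  have "B - {N} \<noteq> {}" using assms(1,3) unfolding states_def block_ok_def by blast
  then obtain i where i: "i \<in> B" "i \<noteq> N" by blast
  with sub have "i \<in> {1..m}" by blast
  with Min_le[OF fin i(1)] show "Min B \<le> m" by simp
  show "1 \<le> Min B" using Min_in[OF fin \<open>B \<noteq> {}\<close>] sub assms(2) by auto
  show "Max B = N" if "N \<in> B" using that sub assms(2) fin by (intro Max_eqI) auto
  show "Max B \<le> m" if "N \<notin> B" using Max_in[OF fin \<open>B \<noteq> {}\<close>] that sub by auto
qed

lemma states_fresh: "xs \<in> states P Q N m \<Longrightarrow> Suc m < N \<Longrightarrow> B \<in> set xs \<Longrightarrow> Suc m \<notin> B"
  using states_block(2)[of xs P Q N m B] by auto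

lemma states_disjoint:
  assumes "xs \<in> states P Q N m" "B \<in> set xs" "C \<in> set xs" "B \<noteq> C"
  shows "B \<inter> C \<subseteq> {N}"
proof -
  obtain p q where "p < length xs" "B = xs ! p" "q < length xs" "C = xs ! q"
    using assms(2,3) by (auto simp: in_set_conv_nth)
  moreover from this have "p < q \<or> q < p" using assms(4) by (metis linorder_neqE_nat)
  ultimately show ?thesis
    using assms(1) by (auto simp: states_def sorted_wrt_iff_nth_less)
qed

lemma states_distinct: "xs \<in> states P Q N m \<Longrightarrow> distinct xs"
  unfolding distinct_conv_nth states_def block_ok_def sorted_wrt_iff_nth_less mem_Collect_eq
  by (metis Diff_eq_empty_iff inf.idem linorder_neqE_nat nth_mem)

lemma states_obtain_block:
  assumes ys: "ys \<in> states P Q N m" and i: "i \<in> {1..m}"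
  obtains us B vs where "ys = us @ B # vs" "i \<in> B" "block_ok P Q N B" "B \<subseteq> insert N {1..m}"
proof -
  have U: "\<Union> (set ys) - {N} = {1..m}" using ys by (simp add: states_def)
  with i obtain B where B: "B \<in> set ys" "i \<in> B" by blast
  from B(1) obtain us vs where "ys = us @ B # vs" by (meson split_list)
  moreover have "B \<subseteq> insert N {1..m}" using U B(1) by blast
  ultimately show thesis using that B ys by (simp add: states_def)
qed

lemma states_0: "states P Q N 0 = {[]}"
proof (intro equalityI subsetI)
  fix xs assume xs: "xs \<in> states P Q N 0"
  have "B \<notin> set xs" for B
  proof
    assume B: "B \<in> set xs"
    then have "block_ok P Q N B" using xs by (simp add: states_def)
    then have "B - {N} \<noteq> {}" by (simp add: block_ok_def)
    moreover have "B - {N} \<subseteq> \<Union> (set xs) - {N}" using B by blast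
    moreover have "\<Union> (set xs) - {N} = {}" using xs by (simp add: states_def)
    ultimately show False by simp
  qed
  then show "xs \<in> {[]}" by (cases xs) auto
qed (simp add: states_def)

text \<open>
  The numbers of blocks and of active blocks in a state depend only on the openers and closers.
\<close>

lemma length_states:
  assumes xs: "xs \<in> states P Q N m" and N: "m < N"
  shows "length xs = card (P \<inter> {1..m})"
proof -
  note b = states_block[OF xs N]
  have "bij_betw Min (set xs) (P \<inter> {1..m})"
    unfolding bij_betw_def
  proof
    show "inj_on Min (set xs)"
    proof (rule inj_onI, rule ccontr)
      fix B C assume BC: "B \<in> set xs" "C \<in> set xs" "Min B = Min C" "B \<noteq> C"
      then have "Min B \<in> B \<inter> C" using b(1,3) by (metis IntI Min_in)
      then have "Min B = N" using states_disjoint[OF xs BC(1,2,4)] by blast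
      with b(5)[OF BC(1)] N show False by simp
    qed
    have "Min B \<in> P \<inter> {1..m}" if "B \<in> set xs" for B
    proof -
      have "Min B \<in> B" using b(1,3) that by (simp add: Min_in)
      moreover have "Min B \<noteq> N" using b(5) that N by fastforce
      moreover have "block_ok P Q N B" using xs that by (simp add: states_def)
      ultimately have "Min B \<in> P" using b(1) that by (auto simp: block_ok_def)
      with b(4,5) that show ?thesis by simp
    qed
    moreover have "i \<in> Min ` set xs" if "i \<in> P" "i \<in> {1..m}" for i
    proof -
      have "i \<in> \<Union> (set xs) - {N}" using xs that(2) by (simp add: states_def)
      then obtain B where B: "B \<in> set xs" "i \<in> B" "i \<noteq> N" by auto
      moreover from this have "block_ok P Q N B" using xs by (simp add: states_def)
      ultimately have "Min B = i" using that b(1) by (intro Min_eqI) (auto simp: block_ok_def)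
      with B show ?thesis by blast
    qed
    ultimately show "Min ` set xs = P \<inter> {1..m}" by blast
  qed
  then show ?thesis
    using bij_betw_same_card distinct_card[OF states_distinct[OF xs]] by metis
qed

lemma card_active_states:
  assumes xs: "xs \<in> states P Q N m" and N: "m < N"
  shows "card {p. p < length xs \<and> N \<in> xs ! p} = card (P \<inter> {1..m}) - card (Q \<inter> {1..m})"
proof -
  note b = states_block[OF xs N]
  have closed: "B \<in> set xs \<and> N \<notin> B" if "B \<in> set (filter (\<lambda>B. N \<notin> B) xs)" for B
    using that by simp
  have "bij_betw Max (set (filter (\<lambda>B. N \<notin> B) xs)) (Q \<inter> {1..m})"
    unfolding bij_betw_def
  proof
    show "inj_on Max (set (filter (\<lambda>B. N \<notin> B) xs))"
    proof (rule inj_onI, rule ccontr)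
      fix B C assume BC: "B \<in> set (filter (\<lambda>B. N \<notin> B) xs)" "C \<in> set (filter (\<lambda>B. N \<notin> B) xs)"
        "Max B = Max C" "B \<noteq> C"
      then have "Max B \<in> B \<inter> C" using b(1,3) closed by (metis IntI Max_in)
      then have "Max B = N" using states_disjoint[OF xs, of B C] BC by auto
      with b(7)[of B] BC(1) N show False by simp
    qed
    have "Max B \<in> Q \<inter> {1..m}" if "B \<in> set xs" "N \<notin> B" for B
    proof -
      have "Max B \<in> B" using b(1,3) that by (simp add: Max_in)
      moreover have "Max B \<noteq> N" using b(7) that N by fastforce
      moreover have "block_ok P Q N B" using xs that by (simp add: states_def)
      ultimately have "Max B \<in> Q" using b(1) that by (auto simp: block_ok_def)
      moreover have "1 \<le> Max B"
        using b(2)[OF that(1)] \<open>Max B \<in> B\<close> \<open>Max B \<noteq> N\<close> by auto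
      ultimately show ?thesis using b(7) that by simp
    qed
    moreover have "i \<in> Max ` set (filter (\<lambda>B. N \<notin> B) xs)" if "i \<in> Q" "i \<in> {1..m}" for i
    proof -
      have "i \<in> \<Union> (set xs) - {N}" using xs that(2) by (simp add: states_def)
      then obtain B where B: "B \<in> set xs" "i \<in> B" "i \<noteq> N" by auto
      moreover from this have "block_ok P Q N B" using xs by (simp add: states_def)
      ultimately have le: "\<forall>j\<in>B. j \<le> i" using that by (auto simp: block_ok_def)
      then have "Max B = i" using B b(1) by (intro Max_eqI) auto
      moreover have "N \<notin> B" using le that(2) N by auto
      ultimately show ?thesis using B(1) by auto
    qed
    ultimately show "Max ` set (filter (\<lambda>B. N \<notin> B) xs) = Q \<inter> {1..m}" by auto
  qed
  then have "length (filter (\<lambda>B. N \<notin> B) xs) = card (Q \<inter> {1..m})"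
    using bij_betw_same_card distinct_card[OF distinct_filter[OF states_distinct[OF xs]]] by metis
  with sum_length_filter_compl[of "\<lambda>B. N \<in> B" xs] length_states[OF xs N]
  show ?thesis by (simp add: length_filter_conv_card)
qed

lemma Int_subset_singleton_iff: "X \<inter> Y \<subseteq> {a} \<longleftrightarrow> (X - {a}) \<inter> Y = {}"
  by blast

section \<open>Inserting an opener\<close>

text \<open>
  One direction shows that the insertion of an opener leads to a state, the other that it reaches
  every state.
\<close>

lemma states_open_iff:
  assumes N: "Suc m < N" and P: "Suc m \<in> P" and X: "X = (if Suc m \<in> Q then {Suc m} else {Suc m, N})"
  shows "ys @ X # zs \<in> states P Q N (Suc m) \<longleftrightarrow> ys @ zs \<in> states P Q N m"
proof -
  have okX: "block_ok P Q N X" using N P X by (auto simp: block_ok_def)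
  have X': "X - {N} = {Suc m}" using N X by auto
  have disj: "X \<inter> Y \<subseteq> {N} \<longleftrightarrow> Suc m \<notin> Y" "Y \<inter> X \<subseteq> {N} \<longleftrightarrow> Suc m \<notin> Y" for Y
    unfolding Int_commute[of Y X] Int_subset_singleton_iff X' by simp_all
  have sorted: "sorted_wrt (\<lambda>B C. B \<inter> C \<subseteq> {N}) (ys @ X # zs) \<longleftrightarrow>
      sorted_wrt (\<lambda>B C. B \<inter> C \<subseteq> {N}) (ys @ zs) \<and> Suc m \<notin> \<Union> (set (ys @ zs))"
    by (simp add: sorted_wrt_append disj ball_conj_distrib) blast
  have union: "\<Union> (set (ys @ X # zs)) - {N} = insert (Suc m) (\<Union> (set (ys @ zs)) - {N})"
    using X' by auto
  have ins: "insert (Suc m) U = {1..Suc m} \<longleftrightarrow> U = {1..m}" if "Suc m \<notin> U" for U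
    using that insert_ident[of "Suc m" U "{1..m}"] by (simp add: atLeastAtMostSuc_conv)
  show ?thesis
  proof (cases "Suc m \<in> \<Union> (set (ys @ zs))")
    case True
    then have "Suc m \<in> \<Union> (set (ys @ zs)) - {N}" using N by simp
    then have "\<Union> (set (ys @ zs)) - {N} \<noteq> {1..m}"
      by (metis Suc_n_not_le_n atLeastAtMost_iff)
    with True show ?thesis unfolding states_def mem_Collect_eq sorted by blast
  next
    case False
    then have "insert (Suc m) (\<Union> (set (ys @ zs)) - {N}) = {1..Suc m} \<longleftrightarrow>
        \<Union> (set (ys @ zs)) - {N} = {1..m}"
      by (intro ins) blast
    then show ?thesis
      unfolding states_def mem_Collect_eq sorted union using False okX by simp
  qed
qed

text \<open>
  Insertion of a new block \<open>X\<close> into the gap with \<open>p\<close> blocks on its left.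
\<close>

definition gap_insert :: "'a \<Rightarrow> 'a list \<times> nat \<Rightarrow> 'a list" where
  "gap_insert X = (\<lambda>(xs, p). take p xs @ X # drop p xs)"

lemma bij_betw_gap_insert:
  assumes N: "Suc m < N" and P: "Suc m \<in> P"
    and X: "X = (if Suc m \<in> Q then {Suc m} else {Suc m, N})"
  shows "bij_betw (gap_insert X) (SIGMA xs:states P Q N m. {..<Suc (length xs)}) (states P Q N (Suc m))"
  unfolding bij_betw_def
proof
  have X_new: "X \<notin> set xs" if "xs \<in> states P Q N m" for xs
    using states_fresh[OF that N] X by auto
  show "inj_on (gap_insert X) (SIGMA xs:states P Q N m. {..<Suc (length xs)})"
  proof (rule inj_onI, clarify)
    fix xs p ys q
    assume xs: "xs \<in> states P Q N m" "p < Suc (length xs)"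
      and ys: "ys \<in> states P Q N m" "q < Suc (length ys)"
      and eq: "gap_insert X (xs, p) = gap_insert X (ys, q)"
    have "X \<notin> set (take p xs)" "X \<notin> set (drop p xs)"
      using X_new[OF xs(1)] by (auto dest: in_set_takeD in_set_dropD)
    with eq have "take p xs = take q ys" "drop p xs = drop q ys"
      by (simp_all add: gap_insert_def append_Cons_eq_iff)
    moreover from this(1) have "p = q" using xs(2) ys(2) by (metis length_take less_Suc_eq_le min.absorb2)
    ultimately show "xs = ys \<and> p = q" by (metis append_take_drop_id)
  qed
  show "gap_insert X ` (SIGMA xs:states P Q N m. {..<Suc (length xs)}) = states P Q N (Suc m)"
  proof
    show "gap_insert X ` (SIGMA xs:states P Q N m. {..<Suc (length xs)}) \<subseteq> states P Q N (Suc m)"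
      by (auto simp: gap_insert_def states_open_iff[OF N P X])
    show "states P Q N (Suc m) \<subseteq> gap_insert X ` (SIGMA xs:states P Q N m. {..<Suc (length xs)})"
    proof
      fix ys assume ys: "ys \<in> states P Q N (Suc m)"
      then obtain us B vs where B: "ys = us @ B # vs" "Suc m \<in> B" "block_ok P Q N B"
        "B \<subseteq> insert N {1..Suc m}"
        by (rule states_obtain_block[where i = "Suc m"]) auto
      have "\<forall>j\<in>B. Suc m \<le> j" using B(2,3) P N by (auto simp: block_ok_def)
      then have "B \<subseteq> {Suc m, N}" using B(4) by fastforce
      moreover have "Suc m \<in> Q \<longleftrightarrow> N \<notin> B"
      proof -
        have "Suc m \<in> Q \<longleftrightarrow> (\<forall>j\<in>B. j \<le> Suc m)" using B(2,3) N by (auto simp: block_ok_def)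
        with \<open>B \<subseteq> {Suc m, N}\<close> N show ?thesis by auto
      qed
      ultimately have "B = X" using B(2) X by auto
      with ys B(1) have "us @ vs \<in> states P Q N m" by (simp add: states_open_iff[OF N P X])
      moreover have "ys = gap_insert X (us @ vs, length us)"
        using B(1) \<open>B = X\<close> by (simp add: gap_insert_def)
      ultimately show "ys \<in> gap_insert X ` (SIGMA xs:states P Q N m. {..<Suc (length xs)})"
        by (intro image_eqI[where x = "(us @ vs, length us)"]) auto
    qed
  qed
qed

text \<open>
  A new block placed to the left of an old one has one crossing with it if the old block is active, and is
  \<open>\<succ>\<close> it if the old block is complete. Placed to the right of an old one, it contributes nothing.
\<close>

lemma new_block_weights:
  assumes xs: "xs \<in> states P Q N m" and N: "Suc m < N" and Y: "Y \<in> set xs"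
    and X: "X = {Suc m} \<or> X = {Suc m, N}"
  shows "crossings Y X = 0" "crossings X Y = of_bool (N \<in> Y)"
    "\<not> block_gt Y X" "block_gt X Y \<longleftrightarrow> N \<notin> Y"
proof -
  note b = states_block[OF xs _ Y]
  have MX: "Min X = Suc m" "Max X \<le> N" "Suc m \<le> Max X" using X N by auto
  have none: "{i \<in> Y. Min X < i \<and> i < Max X} = {}" using b(2) N MX by auto
  show "crossings Y X = 0" unfolding crossings_def none by simp
  show "\<not> block_gt Y X" using b(5) N MX by (auto simp: block_gt_def)
  show "block_gt X Y \<longleftrightarrow> N \<notin> Y" using b(6,7) N MX by (auto simp: block_gt_def)
  have "{i \<in> X. Min Y < i \<and> i < Max Y} = (if N \<in> Y then {Suc m} else {})"
    using X N b(5,6,7) by auto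
  then show "crossings X Y = of_bool (N \<in> Y)" by (simp add: crossings_def)
qed

lemma rsb_gap_insert:
  assumes xs: "xs \<in> states P Q N m" and N: "Suc m < N" and p: "p \<le> length xs"
    and X: "X = {Suc m} \<or> X = {Suc m, N}"
  shows "rsb (gap_insert X (xs, p)) = rsb xs + card {q. p \<le> q \<and> q < length xs \<and> N \<in> xs ! q}"
proof -
  note w = new_block_weights[OF xs N _ X]
  have "(\<Sum>y\<leftarrow>take p xs. crossings y X) = (\<Sum>y\<leftarrow>take p xs. 0)"
    using w(1) by (intro arg_cong[of _ _ sum_list] map_cong) (auto dest: in_set_takeD)
  moreover have "(\<Sum>y\<leftarrow>drop p xs. crossings X y) = (\<Sum>y\<leftarrow>drop p xs. of_bool (N \<in> y))"
    using w(2) by (intro arg_cong[of _ _ sum_list] map_cong) (auto dest: in_set_dropD)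
  ultimately show ?thesis
    unfolding gap_insert_def rsb_def by (simp add: pair_sum_insert sum_list_of_bool_drop)
qed

lemma rsb_bInv_gap_insert:
  assumes xs: "xs \<in> states P Q N m" and N: "Suc m < N" and p: "p \<le> length xs"
    and X: "X = {Suc m} \<or> X = {Suc m, N}"
  shows "rsb (gap_insert X (xs, p)) + bInv (gap_insert X (xs, p)) = rsb xs + bInv xs + (length xs - p)"
proof -
  note w = new_block_weights[OF xs N _ X]
  let ?w = "\<lambda>B C. crossings B C + of_bool (block_gt B C)"
  have "(\<Sum>y\<leftarrow>take p xs. ?w y X) = (\<Sum>y\<leftarrow>take p xs. 0)"
    using w(1,3) by (intro arg_cong[of _ _ sum_list] map_cong) (auto dest: in_set_takeD)
  moreover have "(\<Sum>y\<leftarrow>drop p xs. ?w X y) = (\<Sum>y\<leftarrow>drop p xs. 1)"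
    using w(2,4) by (intro arg_cong[of _ _ sum_list] map_cong) (auto dest: in_set_dropD)
  ultimately show ?thesis
    unfolding gap_insert_def rsb_def bInv_eq_pair_sum pair_sum_add[symmetric]
    by (simp add: pair_sum_insert sum_list_triv)
qed

lemma block_descents_bounds: "j \<in> block_descents xs \<Longrightarrow> 1 \<le> j \<and> j < length xs"
  by (simp add: block_descents_def)

lemma finite_block_descents [simp]: "finite (block_descents xs)"
  by (rule finite_subset[of _ "{..<length xs}"]) (auto simp: block_descents_def)

lemma bMaj_insert:
  assumes p: "p \<le> length xs"
    and not_gt: "\<And>B. B \<in> set xs \<Longrightarrow> \<not> block_gt B X"
    and gt: "p \<in> block_descents xs \<Longrightarrow> block_gt X (xs ! p)"
  shows "bMaj (take p xs @ X # drop p xs) = bMaj xs + card {j \<in> block_descents xs. p \<le> j} +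
    (if p < length xs \<and> block_gt X (xs ! p) \<and> p \<notin> block_descents xs then Suc p else 0)"
proof -
  let ?D = "block_descents xs" and ?c = "p < length xs \<and> block_gt X (xs ! p) \<and> p \<notin> block_descents xs"
  let ?xs' = "take p xs @ X # drop p xs"
  have nth: "?xs' ! q = (if q < p then xs ! q else if q = p then X else xs ! (q - 1))" for q
    using p by (auto simp: nth_append nth_Cons' min_def)
  \<comment> \<open>A descent strictly to the right of the gap moves one step to the right. A descent at the gap
    itself is replaced by one at \<open>Suc p\<close>, so it also moves one step.\<close>
  have "block_descents ?xs' = {j \<in> ?D. j < p} \<union> Suc ` {j \<in> ?D. p \<le> j} \<union> (if ?c then {Suc p} else {})"
    (is "?L = ?R")
  proof (rule set_eqI)
    fix j
    consider "j < p" | "j = p" | "j = Suc p" | i where "j = Suc i" "p < i"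
      by (metis Suc_lessE less_Suc_eq linorder_cases)
    then show "j \<in> ?L \<longleftrightarrow> j \<in> ?R"
    proof cases
      case 2
      have "\<not> block_gt (xs ! (p - 1)) X" if "1 \<le> p" using not_gt that p by simp
      with 2 show ?thesis using p by (auto simp: block_descents_def nth)
    next
      case 3
      then show ?thesis using p gt by (auto simp: nth image_iff block_descents_def)
    next
      case 4
      then show ?thesis using p by (auto simp: nth image_iff block_descents_def)
    qed (use p in \<open>auto simp: nth image_iff block_descents_def\<close>)
  qed
  moreover have "{j \<in> ?D. j < p} \<inter> Suc ` {j \<in> ?D. p \<le> j} = {}"
    and "({j \<in> ?D. j < p} \<union> Suc ` {j \<in> ?D. p \<le> j}) \<inter> (if ?c then {Suc p} else {}) = {}"
    by auto
  ultimately have "bMaj ?xs' = \<Sum> {j \<in> ?D. j < p} + \<Sum> (Suc ` {j \<in> ?D. p \<le> j}) +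
      \<Sum> (if ?c then {Suc p} else {})"
    unfolding bMaj_def by (simp add: sum.union_disjoint del: if_split)
  also have "\<Sum> (Suc ` {j \<in> ?D. p \<le> j}) = \<Sum> {j \<in> ?D. p \<le> j} + card {j \<in> ?D. p \<le> j}"
    by (subst sum.reindex) (simp_all add: sum_Suc)
  also have "\<Sum> {j \<in> ?D. j < p} + (\<Sum> {j \<in> ?D. p \<le> j} + card {j \<in> ?D. p \<le> j}) =
      \<Sum> ({j \<in> ?D. j < p} \<union> {j \<in> ?D. p \<le> j}) + card {j \<in> ?D. p \<le> j}"
    by (subst sum.union_disjoint) auto
  also have "{j \<in> ?D. j < p} \<union> {j \<in> ?D. p \<le> j} = ?D" by auto
  finally show ?thesis by (simp add: bMaj_def)
qed

text \<open>
  A descent is the position, counted from 1, of the left one of two blocks, and hence the list position,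
  counted from 0, of the right one. This is why descents and list positions can be put into one set \<open>A\<close>.
\<close>

lemma rsb_bMaj_gap_insert:
  assumes xs: "xs \<in> states P Q N m" and N: "Suc m < N" and p: "p \<le> length xs"
    and X: "X = {Suc m} \<or> X = {Suc m, N}"
  defines "A \<equiv> {q. q < length xs \<and> (N \<in> xs ! q \<or> q \<in> block_descents xs)}"
  shows "rsb (gap_insert X (xs, p)) + bMaj (gap_insert X (xs, p)) =
    rsb xs + bMaj xs + (card {q \<in> A. p \<le> q} + (if p < length xs \<and> p \<notin> A then Suc p else 0))"
proof -
  note w = new_block_weights[OF xs N _ X]
  \<comment> \<open>The right block of a descent is complete, so descents and active positions are disjoint.\<close>
  have closed: "N \<notin> xs ! j" if "j \<in> block_descents xs" for j
  proof
    assume "N \<in> xs ! j"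
    moreover have "xs ! j \<in> set xs" "xs ! (j - 1) \<in> set xs"
      using that by (auto simp: block_descents_def)
    ultimately have "Max (xs ! j) = N" "Min (xs ! (j - 1)) \<le> m"
      using states_block(5,6)[OF xs] N by auto
    with that N show False by (simp add: block_descents_def block_gt_def)
  qed
  have "bMaj (gap_insert X (xs, p)) = bMaj xs + card {j \<in> block_descents xs. p \<le> j} +
    (if p < length xs \<and> block_gt X (xs ! p) \<and> p \<notin> block_descents xs then Suc p else 0)"
    unfolding gap_insert_def prod.case
    using p w(3,4) closed block_descents_bounds by (intro bMaj_insert) (auto dest: nth_mem)
  moreover have "card {q \<in> A. p \<le> q} =
      card {q. p \<le> q \<and> q < length xs \<and> N \<in> xs ! q} + card {j \<in> block_descents xs. p \<le> j}"
    using closed block_descents_bounds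
    by (subst card_Un_disjoint[symmetric]) (auto simp: A_def intro!: arg_cong[of _ _ card])
  moreover have "(p < length xs \<and> block_gt X (xs ! p) \<and> p \<notin> block_descents xs) \<longleftrightarrow> (p < length xs \<and> p \<notin> A)"
    using w(4) by (auto simp: A_def dest: nth_mem)
  ultimately show ?thesis by (simp add: rsb_gap_insert[OF xs N p X])
qed

section \<open>Adding an element to an active block\<close>

text \<open>
  The block \<open>B\<close> after the element \<open>i\<close> has joined it. If \<open>i\<close> is a closer, the marker is removed and
  the block is complete.
\<close>

definition join_block :: "nat set \<Rightarrow> nat \<Rightarrow> nat \<Rightarrow> nat set \<Rightarrow> nat set" where
  "join_block Q N i B = (if i \<in> Q then insert i (B - {N}) else insert i B)"

lemma mem_join_block: "i \<in> join_block Q N i B"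
  by (simp add: join_block_def)

lemma join_block_inj:
  assumes "join_block Q N i B = join_block Q N i C" "N \<in> B" "N \<in> C" "i \<notin> B" "i \<notin> C"
  shows "B = C"
  using assms by (auto simp: join_block_def set_eq_iff split: if_splits)

lemma states_join_iff:
  assumes N: "Suc m < N" and P: "Suc m \<notin> P" and B: "N \<in> B" "Suc m \<notin> B"
  shows "ys @ join_block Q N (Suc m) B # zs \<in> states P Q N (Suc m) \<longleftrightarrow> ys @ B # zs \<in> states P Q N m"
proof -
  let ?B' = "join_block Q N (Suc m) B"
  have B': "?B' - {N} = insert (Suc m) (B - {N})" using N by (auto simp: join_block_def)
  have disj: "?B' \<inter> Y \<subseteq> {N} \<longleftrightarrow> B \<inter> Y \<subseteq> {N} \<and> Suc m \<notin> Y"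
    "Y \<inter> ?B' \<subseteq> {N} \<longleftrightarrow> Y \<inter> B \<subseteq> {N} \<and> Suc m \<notin> Y" for Y
    unfolding Int_commute[of Y] Int_subset_singleton_iff B' by auto
  have sorted: "sorted_wrt (\<lambda>B C. B \<inter> C \<subseteq> {N}) (ys @ ?B' # zs) \<longleftrightarrow>
      sorted_wrt (\<lambda>B C. B \<inter> C \<subseteq> {N}) (ys @ B # zs) \<and> Suc m \<notin> \<Union> (set (ys @ B # zs))"
    using B by (simp add: sorted_wrt_append disj ball_conj_distrib) blast
  have union: "\<Union> (set (ys @ ?B' # zs)) - {N} = insert (Suc m) (\<Union> (set (ys @ B # zs)) - {N})"
    using B' by auto
  have ins: "insert (Suc m) U = {1..Suc m} \<longleftrightarrow> U = {1..m}" if "Suc m \<notin> U" for U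
    using that insert_ident[of "Suc m" U "{1..m}"] by (simp add: atLeastAtMostSuc_conv)
  have ok: "block_ok P Q N ?B' \<longleftrightarrow> block_ok P Q N B" if U: "\<Union> (set (ys @ B # zs)) - {N} = {1..m}"
  proof -
    have bound: "e \<le> m" if "e \<in> B" "e \<noteq> N" for e
    proof -
      have "e \<in> \<Union> (set (ys @ B # zs)) - {N}" using that by simp
      then show ?thesis unfolding U by simp
    qed
    have mem: "e \<in> ?B' \<longleftrightarrow> e = Suc m \<or> (e \<in> B \<and> (Suc m \<in> Q \<longrightarrow> e \<noteq> N))" for e
      using B by (auto simp: join_block_def)
    have ball_B': "(\<forall>j\<in>?B'. R j) \<longleftrightarrow> R (Suc m) \<and> (\<forall>j\<in>B - {N}. R j) \<and> (Suc m \<in> Q \<or> R N)" for R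
      using B(1) by (auto simp: mem)
    have ball_B: "(\<forall>j\<in>B. R j) \<longleftrightarrow> (\<forall>j\<in>B - {N}. R j) \<and> R N" for R
      using B(1) by auto
    have le: "\<forall>j\<in>B - {N}. j \<le> m" using bound by blast
    have low: "(\<forall>j\<in>?B'. e \<le> j) \<longleftrightarrow> (\<forall>j\<in>B. e \<le> j)" if "e \<in> B - {N}" for e
      unfolding ball_B' ball_B using bspec[OF le that] N by auto
    have high: "(\<forall>j\<in>?B'. j \<le> e) \<longleftrightarrow> (\<forall>j\<in>B. j \<le> e)" if "e \<in> B - {N}" for e
      unfolding ball_B' ball_B using bspec[OF le that] N by auto
    have top: "(\<forall>j\<in>?B'. j \<le> Suc m) \<longleftrightarrow> Suc m \<in> Q"
    proof -
      have "\<forall>j\<in>B - {N}. j \<le> Suc m" using le le_SucI by blast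
      then show ?thesis unfolding ball_B' using N by simp
    qed
    have bottom: "(\<forall>j\<in>?B'. Suc m \<le> j) \<longleftrightarrow> B - {N} = {}"
    proof -
      have "(\<forall>j\<in>B - {N}. Suc m \<le> j) \<longleftrightarrow> B - {N} = {}"
        using le by (metis all_not_in_conv empty_iff not_less_eq_eq)
      then show ?thesis unfolding ball_B' using N by simp
    qed
    have "((e \<in> P \<longleftrightarrow> (\<forall>j\<in>?B'. e \<le> j)) \<and> (e \<in> Q \<longleftrightarrow> (\<forall>j\<in>?B'. j \<le> e))) \<longleftrightarrow>
        (e \<in> P \<longleftrightarrow> (\<forall>j\<in>B. e \<le> j)) \<and> (e \<in> Q \<longleftrightarrow> (\<forall>j\<in>B. j \<le> e))" if "e \<in> B - {N}" for e
      unfolding low[OF that] high[OF that] ..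
    from ball_cong[OF refl this]
    have "B - {N} \<noteq> {} \<and> (\<forall>e\<in>B - {N}. (e \<in> P \<longleftrightarrow> (\<forall>j\<in>?B'. e \<le> j)) \<and> (e \<in> Q \<longleftrightarrow> (\<forall>j\<in>?B'. j \<le> e)))
        \<longleftrightarrow> block_ok P Q N B"
      unfolding block_ok_def by (rule arg_cong)
    moreover have "block_ok P Q N ?B' \<longleftrightarrow> B - {N} \<noteq> {} \<and>
        (\<forall>e\<in>B - {N}. (e \<in> P \<longleftrightarrow> (\<forall>j\<in>?B'. e \<le> j)) \<and> (e \<in> Q \<longleftrightarrow> (\<forall>j\<in>?B'. j \<le> e)))"
      unfolding block_ok_def B' ball_simps top bottom using P by blast
    ultimately show ?thesis by simp
  qed
  show ?thesis
  proof (cases "Suc m \<in> \<Union> (set (ys @ B # zs))")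
    case True
    then have "Suc m \<in> \<Union> (set (ys @ B # zs)) - {N}" using N by simp
    then have "\<Union> (set (ys @ B # zs)) - {N} \<noteq> {1..m}"
      by (metis Suc_n_not_le_n atLeastAtMost_iff)
    with True show ?thesis unfolding states_def mem_Collect_eq sorted by blast
  next
    case False
    then have "insert (Suc m) (\<Union> (set (ys @ B # zs)) - {N}) = {1..Suc m} \<longleftrightarrow>
        \<Union> (set (ys @ B # zs)) - {N} = {1..m}"
      by (intro ins) blast
    moreover have "(\<forall>C\<in>set (ys @ C0 # zs). block_ok P Q N C) \<longleftrightarrow>
        block_ok P Q N C0 \<and> (\<forall>C\<in>set (ys @ zs). block_ok P Q N C)" for C0
      by auto
    ultimately show ?thesis
      unfolding states_def mem_Collect_eq sorted union using False ok by auto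
  qed
qed

text \<open>
  The element \<open>i\<close> joins the block at list position \<open>p\<close>.
\<close>

definition join_at :: "nat set \<Rightarrow> nat \<Rightarrow> nat \<Rightarrow> nat set list \<times> nat \<Rightarrow> nat set list" where
  "join_at Q N i = (\<lambda>(xs, p). xs[p := join_block Q N i (xs ! p)])"

lemma bij_betw_join_at:
  assumes N: "Suc m < N" and P: "Suc m \<notin> P"
  shows "bij_betw (join_at Q N (Suc m)) (SIGMA xs:states P Q N m. {p. p < length xs \<and> N \<in> xs ! p})
    (states P Q N (Suc m))"
  unfolding bij_betw_def
proof
  let ?J = "join_block Q N (Suc m)"
  let ?D = "SIGMA xs:states P Q N m. {p. p < length xs \<and> N \<in> xs ! p}"
  show "inj_on (join_at Q N (Suc m)) ?D"
  proof (rule inj_onI, clarify)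
    fix xs p ys q
    assume xs: "xs \<in> states P Q N m" "p < length xs" "N \<in> xs ! p"
      and ys: "ys \<in> states P Q N m" "q < length ys" "N \<in> ys ! q"
      and "join_at Q N (Suc m) (xs, p) = join_at Q N (Suc m) (ys, q)"
    then have eq: "xs[p := ?J (xs ! p)] = ys[q := ?J (ys ! q)]" by (simp add: join_at_def)
    have len: "length xs = length ys" using eq by (metis length_list_update)
    have pq: "p = q"
    proof (rule ccontr)
      assume "p \<noteq> q"
      then have "?J (xs ! p) = ys ! p" using eq xs(2) by (metis nth_list_update_eq nth_list_update_neq)
      then have "Suc m \<in> ys ! p" using mem_join_block by metis
      with states_fresh[OF ys(1) N] xs(2) len show False by simp
    qed
    have "xs ! j = ys ! j" if "j < length xs" for j
    proof (cases "j = p")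
      case True
      have "?J (xs ! p) = ?J (ys ! p)" using eq xs(2) len pq by (metis nth_list_update_eq)
      with True show ?thesis
        using join_block_inj xs ys pq states_fresh[OF xs(1) N] states_fresh[OF ys(1) N] by (metis nth_mem)
    qed (use eq pq in \<open>metis nth_list_update_neq\<close>)
    with len pq show "xs = ys \<and> p = q" by (simp add: nth_equalityI)
  qed
  show "join_at Q N (Suc m) ` ?D = states P Q N (Suc m)"
  proof
    show "join_at Q N (Suc m) ` ?D \<subseteq> states P Q N (Suc m)"
    proof (clarsimp simp: join_at_def)
      fix xs p assume "xs \<in> states P Q N m" "p < length xs" "N \<in> xs ! p"
      then show "xs[p := ?J (xs ! p)] \<in> states P Q N (Suc m)"
        using states_join_iff[OF N P, of "xs ! p" "take p xs" Q "drop (Suc p) xs"] states_fresh[OF _ N]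
        by (simp add: upd_conv_take_nth_drop id_take_nth_drop[symmetric])
    qed
    show "states P Q N (Suc m) \<subseteq> join_at Q N (Suc m) ` ?D"
    proof
      fix ys assume ys: "ys \<in> states P Q N (Suc m)"
      then obtain us C vs where C: "ys = us @ C # vs" "Suc m \<in> C" "block_ok P Q N C"
        "C \<subseteq> insert N {1..Suc m}"
        by (rule states_obtain_block[where i = "Suc m"]) auto
      have closed: "Suc m \<in> Q \<longleftrightarrow> N \<notin> C"
      proof -
        have "Suc m \<in> Q \<longleftrightarrow> (\<forall>j\<in>C. j \<le> Suc m)" using C(2,3) N by (auto simp: block_ok_def)
        with C(4) N show ?thesis by auto
      qed
      \<comment> \<open>The step is undone by removing \<open>Suc m\<close> and restoring the marker if \<open>Suc m\<close> was a closer.\<close>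
      define B where "B = insert N (C - {Suc m})"
      have B: "N \<in> B" "Suc m \<notin> B" "?J B = C"
        using closed C(2) N by (auto simp: B_def join_block_def)
      with ys C(1) have "us @ B # vs \<in> states P Q N m"
        using states_join_iff[OF N P B(1,2), where Q = Q] by simp
      moreover have "ys = join_at Q N (Suc m) (us @ B # vs, length us)"
        using C(1) B(3) by (simp add: join_at_def)
      ultimately show "ys \<in> join_at Q N (Suc m) ` ?D"
        using B(1) by (intro image_eqI[where x = "(us @ B # vs, length us)"]) auto
    qed
  qed
qed

lemma join_block_weights:
  assumes xs: "xs \<in> states P Q N m" and N: "Suc m < N" and B: "B \<in> set xs" "N \<in> B" and Y: "Y \<in> set xs"
  shows "crossings Y (join_block Q N (Suc m) B) = crossings Y B"
    "crossings (join_block Q N (Suc m) B) Y = crossings B Y + of_bool (N \<in> Y)"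
    "block_gt Y (join_block Q N (Suc m) B) \<longleftrightarrow> block_gt Y B"
    "block_gt (join_block Q N (Suc m) B) Y \<longleftrightarrow> block_gt B Y"
proof -
  let ?C = "join_block Q N (Suc m) B"
  have "m < N" using N by simp
  note b = states_block[OF xs this B(1)] and y = states_block[OF xs this Y]
  have fin: "finite ?C" using b(1) by (simp add: join_block_def)
  have MinC: "Min ?C = Min B"
  proof (rule Min_eqI[OF fin])
    show "Min B \<in> ?C" using Min_in[OF b(1,3)] b(5) N by (auto simp: join_block_def)
    show "Min B \<le> j" if "j \<in> ?C" for j
      using that b(1,5) by (auto simp: join_block_def split: if_splits)
  qed
  have MaxB: "Max B = N" using b(6) B(2) by simp
  have le: "j \<le> m" if "j \<in> B" "j \<noteq> N" for j using b(2) that by auto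
  \<comment> \<open>The maximum may drop from \<open>N\<close> to \<open>Suc m\<close>, but it stays above all of \<open>{1..m}\<close>.\<close>
  have MaxC: "Max ?C = (if Suc m \<in> Q then Suc m else N)"
    using le B(2) N fin by (intro Max_eqI) (force simp: join_block_def)+
  show "block_gt Y ?C \<longleftrightarrow> block_gt Y B"
    using y(5) N by (auto simp: block_gt_def MaxB MaxC)
  show "block_gt ?C Y \<longleftrightarrow> block_gt B Y" by (simp add: block_gt_def MinC)
  have "{i \<in> Y. Min B < i \<and> i < Max ?C} = {i \<in> Y. Min B < i \<and> i < Max B}"
    using y(2) N by (auto simp: MaxB MaxC)
  then show "crossings Y ?C = crossings Y B" by (simp add: crossings_def MinC)
  have "{i \<in> ?C. Min Y < i \<and> i < Max Y} =
      (if N \<in> Y then insert (Suc m) {i \<in> B. Min Y < i \<and> i < Max Y} else {i \<in> B. Min Y < i \<and> i < Max Y})"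
    using y(5,6,7) N by (auto simp: join_block_def)
  moreover have "Suc m \<notin> B" using states_fresh[OF xs N B(1)] .
  ultimately show "crossings ?C Y = crossings B Y + of_bool (N \<in> Y)"
    using b(1) by (simp add: crossings_def)
qed

lemma rsb_join_at:
  assumes xs: "xs \<in> states P Q N m" and N: "Suc m < N" and p: "p < length xs" "N \<in> xs ! p"
  shows "rsb (join_at Q N (Suc m) (xs, p)) = rsb xs + card {q \<in> {q. q < length xs \<and> N \<in> xs ! q}. p < q}"
proof -
  let ?B = "xs ! p" and ?C = "join_block Q N (Suc m) (xs ! p)"
  note w = join_block_weights[OF xs N nth_mem[OF p(1)] p(2)]
  let ?us = "take p xs" and ?vs = "drop (Suc p) xs"
  have "(\<Sum>y\<leftarrow>?us. crossings y ?C) = (\<Sum>y\<leftarrow>?us. crossings y ?B)"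
    using w(1) by (intro arg_cong[of _ _ sum_list] map_cong) (auto dest: in_set_takeD)
  moreover have "(\<Sum>y\<leftarrow>?vs. crossings ?C y) = (\<Sum>y\<leftarrow>?vs. crossings ?B y + of_bool (N \<in> y))"
    using w(2) by (intro arg_cong[of _ _ sum_list] map_cong) (auto dest: in_set_dropD)
  moreover have "\<dots> = (\<Sum>y\<leftarrow>?vs. crossings ?B y) + card {q \<in> {q. q < length xs \<and> N \<in> xs ! q}. p < q}"
    unfolding sum_list_addf sum_list_of_bool_drop by (auto intro!: arg_cong[of _ _ card])
  moreover have "rsb xs = rsb (?us @ ?B # ?vs)" using p(1) by (simp add: id_take_nth_drop[symmetric])
  ultimately show ?thesis
    unfolding join_at_def rsb_def using p(1) by (simp add: upd_conv_take_nth_drop pair_sum_insert)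
qed

lemma block_gt_join_at:
  assumes xs: "xs \<in> states P Q N m" and N: "Suc m < N" and p: "p < length xs" "N \<in> xs ! p"
    and ij: "i < length xs" "j < length xs" "i \<noteq> j"
  shows "block_gt (join_at Q N (Suc m) (xs, p) ! i) (join_at Q N (Suc m) (xs, p) ! j) \<longleftrightarrow>
    block_gt (xs ! i) (xs ! j)"
  using join_block_weights(3,4)[OF xs N nth_mem[OF p(1)] p(2)] ij
  by (cases "i = p"; cases "j = p") (simp_all add: join_at_def)

lemma bInv_join_at:
  assumes "xs \<in> states P Q N m" "Suc m < N" "p < length xs" "N \<in> xs ! p"
  shows "bInv (join_at Q N (Suc m) (xs, p)) = bInv xs"
proof -
  have "length (join_at Q N (Suc m) (xs, p)) = length xs" by (simp add: join_at_def)
  then show ?thesis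
    unfolding bInv_def using block_gt_join_at[OF assms] by (intro arg_cong[of _ _ card]) auto
qed

lemma bMaj_join_at:
  assumes "xs \<in> states P Q N m" "Suc m < N" "p < length xs" "N \<in> xs ! p"
  shows "bMaj (join_at Q N (Suc m) (xs, p)) = bMaj xs"
proof -
  have "length (join_at Q N (Suc m) (xs, p)) = length xs" by (simp add: join_at_def)
  then have "block_descents (join_at Q N (Suc m) (xs, p)) = block_descents xs"
    unfolding block_descents_def using block_gt_join_at[OF assms] by auto
  then show ?thesis by (simp add: bMaj_def)
qed

section \<open>The bijection\<close>

lemma states_bijection:
  assumes "m < N"
  shows "\<exists>\<sigma>. bij_betw \<sigma> (states P Q N m) (states P Q N m) \<and>
    (\<forall>xs\<in>states P Q N m. rsb xs + bMaj xs = rsb (\<sigma> xs) + bInv (\<sigma> xs))"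
  using assms
proof (induction m)
  case 0
  then have "rsb [] + bMaj [] = rsb [] + bInv []" by (simp add: bMaj_def bInv_eq_pair_sum block_descents_def)
  with 0 show ?case by (auto simp: states_0 intro!: exI[of _ id])
next
  case (Suc m)
  let ?S = "states P Q N m"
  from Suc obtain \<sigma> where \<sigma>: "bij_betw \<sigma> ?S ?S"
      "\<And>xs. xs \<in> ?S \<Longrightarrow> rsb xs + bMaj xs = rsb (\<sigma> xs) + bInv (\<sigma> xs)"
    by auto
  note N = \<open>Suc m < N\<close>
  show ?case
  proof (cases "Suc m \<in> P")
    case True
    define X where "X = (if Suc m \<in> Q then {Suc m} else {Suc m, N})"
    then have X: "X = {Suc m} \<or> X = {Suc m, N}" by auto
    let ?k = "card (P \<inter> {1..m})"
    have len: "length xs = ?k" if "xs \<in> ?S" for xs using length_states[OF that] N by simp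
    define A where "A = (\<lambda>xs. {q. q < length xs \<and> (N \<in> xs ! q \<or> q \<in> block_descents xs)})"
    show ?thesis
    proof (rule lift_bijection[where f = "\<lambda>xs. rsb xs + bMaj xs" and g = "\<lambda>xs. rsb xs + bInv xs",
        OF \<sigma> bij_betw_gap_insert[OF N True X_def]])
      fix xs assume xs: "xs \<in> ?S"
      have "A xs \<subseteq> {..<length xs}" by (auto simp: A_def)
      from bij_betw_gap_weight[OF this]
      show "bij_betw (\<lambda>p. card {q \<in> A xs. p \<le> q} + (if p < length xs \<and> p \<notin> A xs then Suc p else 0))
          {..<Suc (length xs)} {..<Suc ?k}"
        by (simp add: len[OF xs])
      show "bij_betw (\<lambda>p. length xs - p) {..<Suc (length xs)} {..<Suc ?k}"
        unfolding len[OF xs] by (rule bij_betw_byWitness[where f' = "\<lambda>p. ?k - p"]) auto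
      fix p assume "p \<in> {..<Suc (length xs)}"
      then have p: "p \<le> length xs" by simp
      show "rsb (gap_insert X (xs, p)) + bMaj (gap_insert X (xs, p)) = rsb xs + bMaj xs +
          (card {q \<in> A xs. p \<le> q} + (if p < length xs \<and> p \<notin> A xs then Suc p else 0))"
        using rsb_bMaj_gap_insert[OF xs N p X] by (simp only: A_def)
      show "rsb (gap_insert X (xs, p)) + bInv (gap_insert X (xs, p)) =
          rsb xs + bInv xs + (length xs - p)"
        by (rule rsb_bInv_gap_insert[OF xs N p X])
    qed
  next
    case False
    let ?A = "\<lambda>xs. {q. q < length xs \<and> N \<in> xs ! q}"
    let ?l = "card (P \<inter> {1..m}) - card (Q \<inter> {1..m})"
    have after: "bij_betw (\<lambda>p. card {q \<in> ?A xs. p < q}) (?A xs) {..<?l}" if "xs \<in> ?S" for xs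
      using bij_betw_count_after[of "?A xs"] card_active_states[OF that] N by simp
    show ?thesis
    proof (rule lift_bijection[where f = "\<lambda>xs. rsb xs + bMaj xs" and g = "\<lambda>xs. rsb xs + bInv xs",
        OF \<sigma> bij_betw_join_at[OF N False]])
      fix xs assume xs: "xs \<in> ?S"
      show "bij_betw (\<lambda>p. card {q \<in> ?A xs. p < q}) (?A xs) {..<?l}"
        and "bij_betw (\<lambda>p. card {q \<in> ?A xs. p < q}) (?A xs) {..<?l}"
        by (rule after[OF xs])+
      fix p assume "p \<in> ?A xs"
      then have p: "xs \<in> ?S" "Suc m < N" "p < length xs" "N \<in> xs ! p" using N xs by auto
      show "rsb (join_at Q N (Suc m) (xs, p)) + bMaj (join_at Q N (Suc m) (xs, p)) =
          rsb xs + bMaj xs + card {q \<in> ?A xs. p < q}"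
        by (simp add: rsb_join_at[OF p] bMaj_join_at[OF p])
      show "rsb (join_at Q N (Suc m) (xs, p)) + bInv (join_at Q N (Suc m) (xs, p)) =
          rsb xs + bInv xs + card {q \<in> ?A xs. p < q}"
        by (simp add: rsb_join_at[OF p] bInv_join_at[OF p])
    qed
  qed
qed

section \<open>Ordered partitions of a given type\<close>

lemma openers_closers_mem:
  assumes \<pi>: "\<pi> \<in> ordered_partitions n k" and B: "B \<in> set \<pi>" "i \<in> B"
  shows "i \<in> openers \<pi> \<longleftrightarrow> i = Min B" "i \<in> closers \<pi> \<longleftrightarrow> i = Max B"
  using ordered_partition_blocks[OF \<pi>] B
  by (auto simp: openers_def closers_def) (metis Min_in, metis Max_in)

text \<open>
  The type carries the same information as the sets of openers and closers.
\<close>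

lemma partition_type_openers_closers:
  assumes \<pi>: "\<pi> \<in> ordered_partitions n k"
  shows "strict_openers \<pi> = openers \<pi> - closers \<pi>" "strict_closers \<pi> = closers \<pi> - openers \<pi>"
    "singletons \<pi> = openers \<pi> \<inter> closers \<pi>"
    "transients \<pi> = {1..n} - (openers \<pi> \<union> closers \<pi>)"
proof -
  note b = ordered_partition_blocks[OF \<pi>]
  have card1: "card B = 1 \<longleftrightarrow> Min B = Max B" if "B \<in> set \<pi>" for B
  proof
    assume eq: "Min B = Max B"
    have "B = {Min B}"
    proof
      show "B \<subseteq> {Min B}"
      proof
        fix i assume "i \<in> B"
        with b(4)[OF that] have "Min B \<le> i" "i \<le> Max B" by auto
        with eq show "i \<in> {Min B}" by simp
      qed
      show "{Min B} \<subseteq> B" using b(4,5)[OF that] by simp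
    qed
    then show "card B = 1" by (metis card_1_singleton_iff One_nat_def)
  qed (auto simp: card_1_singleton_iff)
  have Min: "Min B \<in> B" and Max: "Max B \<in> B" if "B \<in> set \<pi>" for B
    using b(4,5)[OF that] by auto
  have MinC: "Min B \<in> closers \<pi> \<longleftrightarrow> card B = 1" if "B \<in> set \<pi>" for B
    using openers_closers_mem(2)[OF \<pi> that Min[OF that]] card1[OF that] by simp
  have MaxO: "Max B \<in> openers \<pi> \<longleftrightarrow> card B = 1" if "B \<in> set \<pi>" for B
    using openers_closers_mem(1)[OF \<pi> that Max[OF that]] card1[OF that] by auto
  show so: "strict_openers \<pi> = openers \<pi> - closers \<pi>"
    using MinC by (auto simp: strict_openers_def openers_def)
  show sc: "strict_closers \<pi> = closers \<pi> - openers \<pi>"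
    using MaxO by (auto simp: strict_closers_def closers_def)
  show s: "singletons \<pi> = openers \<pi> \<inter> closers \<pi>"
  proof (intro equalityI subsetI)
    fix i assume "i \<in> singletons \<pi>"
    then obtain B where B: "B \<in> set \<pi>" "card B = 1" "i \<in> B" by (auto simp: singletons_def)
    then have "i = Min B" using Min by (metis card_1_singletonE singletonD)
    with B show "i \<in> openers \<pi> \<inter> closers \<pi>" using MinC by (auto simp: openers_def)
  next
    fix i assume i: "i \<in> openers \<pi> \<inter> closers \<pi>"
    then obtain B where "B \<in> set \<pi>" "i = Min B" by (auto simp: openers_def)
    with i show "i \<in> singletons \<pi>" using MinC Min by (auto simp: singletons_def)
  qed
  have "ground \<pi> = {1..n}" using b(3) by (simp add: ground_def)
  then show "transients \<pi> = {1..n} - (openers \<pi> \<union> closers \<pi>)"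
    unfolding transients_def so sc s by auto
qed

lemma partition_type_eq_iff:
  assumes "\<pi> \<in> ordered_partitions n k" "\<pi>' \<in> ordered_partitions n k"
  shows "partition_type \<pi> = partition_type \<pi>' \<longleftrightarrow>
    openers \<pi> = openers \<pi>' \<and> closers \<pi> = closers \<pi>'"
  unfolding partition_type_def partition_type_openers_closers[OF assms(1)]
    partition_type_openers_closers[OF assms(2)] by auto

lemma ordered_partition_in_states:
  assumes \<pi>: "\<pi> \<in> ordered_partitions n k"
  shows "\<pi> \<in> states (openers \<pi>) (closers \<pi>) (Suc n) n"
proof -
  note b = ordered_partition_blocks[OF \<pi>]
  have N: "Suc n \<notin> \<Union> (set \<pi>)" unfolding b(3) by simp
  have "sorted_wrt (\<lambda>B C. B \<inter> C \<subseteq> {Suc n}) \<pi>"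
    unfolding sorted_wrt_iff_nth_less
  proof (intro allI impI)
    fix p q assume "p < q" "q < length \<pi>"
    then have "\<pi> ! p \<noteq> \<pi> ! q" "\<pi> ! p \<in> set \<pi>" "\<pi> ! q \<in> set \<pi>"
      using b(2) by (auto simp: nth_eq_iff_index_eq)
    then show "\<pi> ! p \<inter> \<pi> ! q \<subseteq> {Suc n}" using b(6) by blast
  qed
  moreover have "\<Union> (set \<pi>) - {Suc n} = {1..n}" unfolding b(3) by auto
  moreover have "block_ok (openers \<pi>) (closers \<pi>) (Suc n) B" if "B \<in> set \<pi>" for B
  proof -
    have "i \<in> openers \<pi> \<longleftrightarrow> (\<forall>j\<in>B. i \<le> j)" "i \<in> closers \<pi> \<longleftrightarrow> (\<forall>j\<in>B. j \<le> i)" if "i \<in> B" for i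
      unfolding openers_closers_mem[OF \<pi> \<open>B \<in> set \<pi>\<close> that] using b(4,5) \<open>B \<in> set \<pi>\<close> that
      by (auto intro: Min_eqI[symmetric] Max_eqI[symmetric])
    moreover have "B - {Suc n} = B" using N that by blast
    ultimately show ?thesis unfolding block_ok_def using b(5) that by simp
  qed
  ultimately show ?thesis by (simp add: states_def)
qed

text \<open>
  At stage \<open>n\<close>, with \<open>Suc n\<close> as the marker, no block is active any more, and the states are the ordered
  partitions of the type in question.
\<close>

lemma ordered_partitions_of_type_eq_states:
  assumes \<pi>: "\<pi> \<in> ordered_partitions n k"
  defines "P \<equiv> openers \<pi>" and "Q \<equiv> closers \<pi>"
  shows "ordered_partitions_of_type n k (partition_type \<pi>) = states P Q (Suc n) n"
proof (intro equalityI subsetI)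
  fix \<rho> assume "\<rho> \<in> ordered_partitions_of_type n k (partition_type \<pi>)"
  then have "\<rho> \<in> ordered_partitions n k" "openers \<rho> = P" "closers \<rho> = Q"
    using partition_type_eq_iff[OF _ \<pi>] by (auto simp: ordered_partitions_of_type_def P_def Q_def)
  with ordered_partition_in_states show "\<rho> \<in> states P Q (Suc n) n" by metis
next
  fix \<rho> assume \<rho>: "\<rho> \<in> states P Q (Suc n) n"
  note b = ordered_partition_blocks[OF \<pi>]
  have \<pi>_state: "\<pi> \<in> states P Q (Suc n) n"
    unfolding P_def Q_def by (rule ordered_partition_in_states[OF \<pi>])
  \<comment> \<open>The numbers of blocks and of active blocks are the same as for \<open>\<pi>\<close>: \<open>k\<close> and \<open>0\<close>.\<close>
  have "length \<rho> = k"
    using length_states[OF \<rho>] length_states[OF \<pi>_state] b(1) by simp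
  have "{p. p < length \<pi> \<and> Suc n \<in> \<pi> ! p} = {}"
  proof -
    have "Suc n \<notin> \<Union> (set \<pi>)" unfolding b(3) by simp
    then show ?thesis by (auto dest: nth_mem)
  qed
  moreover have "card {p. p < length \<rho> \<and> Suc n \<in> \<rho> ! p} = card {p. p < length \<pi> \<and> Suc n \<in> \<pi> ! p}"
    unfolding card_active_states[OF \<rho> lessI] card_active_states[OF \<pi>_state lessI] ..
  ultimately have "card {p. p < length \<rho> \<and> Suc n \<in> \<rho> ! p} = 0" by (simp only: card.empty)
  moreover have "finite {p. p < length \<rho> \<and> Suc n \<in> \<rho> ! p}" by simp
  ultimately have "{p. p < length \<rho> \<and> Suc n \<in> \<rho> ! p} = {}" by (simp only: card_0_eq)
  then have closed: "Suc n \<notin> B" if "B \<in> set \<rho>" for B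
    using that by (auto simp: in_set_conv_nth)
  have U: "\<Union> (set \<rho>) = {1..n}"
  proof -
    have "\<Union> (set \<rho>) - {Suc n} = \<Union> (set \<rho>)" using closed by blast
    then show ?thesis using \<rho> by (simp add: states_def)
  qed
  have "disjoint (set \<rho>)"
  proof (rule disjointI)
    fix B C assume "B \<in> set \<rho>" "C \<in> set \<rho>" "B \<noteq> C"
    then have "B \<inter> C \<subseteq> {Suc n}" "Suc n \<notin> B" using states_disjoint[OF \<rho>] closed by simp_all
    then show "B \<inter> C = {}" by blast
  qed
  moreover have "{} \<notin> set \<rho>" using states_block(3)[OF \<rho>] by auto
  ultimately have \<rho>_part: "\<rho> \<in> ordered_partitions n k"
    using U states_distinct[OF \<rho>] \<open>length \<rho> = k\<close> by (simp add: ordered_partitions_def partition_on_def)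
  have eq: "i \<in> openers \<rho> \<longleftrightarrow> i \<in> P" "i \<in> closers \<rho> \<longleftrightarrow> i \<in> Q" if i: "i \<in> {1..n}" for i
  proof -
    obtain B where B: "B \<in> set \<rho>" "i \<in> B" using i U by blast
    note b' = ordered_partition_blocks(4,5)[OF \<rho>_part B(1)]
    have "block_ok P Q (Suc n) B" using \<rho> B(1) by (simp add: states_def)
    then have ok: "i \<in> P \<longleftrightarrow> (\<forall>j\<in>B. i \<le> j)" "i \<in> Q \<longleftrightarrow> (\<forall>j\<in>B. j \<le> i)"
      using B(2) i by (auto simp: block_ok_def)
    show "i \<in> openers \<rho> \<longleftrightarrow> i \<in> P"
      unfolding openers_closers_mem(1)[OF \<rho>_part B] ok using b' B(2)
      by (auto intro: Min_eqI[symmetric])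
    show "i \<in> closers \<rho> \<longleftrightarrow> i \<in> Q"
      unfolding openers_closers_mem(2)[OF \<rho>_part B] ok using b' B(2)
      by (auto intro: Max_eqI[symmetric])
  qed
  have sub: "openers \<tau> \<subseteq> {1..n}" "closers \<tau> \<subseteq> {1..n}" if \<tau>: "\<tau> \<in> ordered_partitions n k" for \<tau>
  proof -
    note t = ordered_partition_blocks[OF \<tau>]
    have "Min B \<in> {1..n}" "Max B \<in> {1..n}" if "B \<in> set \<tau>" for B
      unfolding t(3)[symmetric] using t(4,5)[OF that] that by (auto intro: Min_in Max_in)
    then show "openers \<tau> \<subseteq> {1..n}" "closers \<tau> \<subseteq> {1..n}"
      unfolding openers_def closers_def by blast+
  qed
  have "openers \<rho> = P" using eq(1) sub(1)[OF \<rho>_part] sub(1)[OF \<pi>] unfolding P_def by blast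
  moreover have "closers \<rho> = Q" using eq(2) sub(2)[OF \<rho>_part] sub(2)[OF \<pi>] unfolding Q_def by blast
  ultimately show "\<rho> \<in> ordered_partitions_of_type n k (partition_type \<pi>)"
    using \<rho>_part partition_type_eq_iff[OF \<rho>_part \<pi>]
    by (simp add: ordered_partitions_of_type_def P_def Q_def)
qed

lemma equidistributed_onI:
  assumes "bij_betw \<sigma> A A" "\<And>x. x \<in> A \<Longrightarrow> f x = g (\<sigma> x)"
  shows "equidistributed_on A f g"
  unfolding equidistributed_on_def
proof
  fix v
  have "bij_betw \<sigma> {x \<in> A. f x = v} {x \<in> A. g x = v}"
    using assms by (intro bij_betw_Collect) simp_all
  then show "card {x \<in> A. f x = v} = card {x \<in> A. g x = v}" by (rule bij_betw_same_card)
qed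

theorem theorem3p3:
  fixes n k :: nat and t :: ptype
  assumes "1 \<le> k" and "k \<le> n"
  shows "equidistributed_on (ordered_partitions_of_type n k t)
    (\<lambda>\<pi>. (MAK \<pi> + bMaj \<pi>, MAK' \<pi> + bMaj \<pi>, cmajLSB \<pi>))
    (\<lambda>\<pi>. (MAK \<pi> + bInv \<pi>, MAK' \<pi> + bInv \<pi>, cinvLSB \<pi>))"
proof (cases "ordered_partitions_of_type n k t = {}")
  case True
  then show ?thesis by (simp add: equidistributed_on_def)
next
  case False
  \<comment> \<open>The type is realized by some \<open>\<pi>\<^sub>0\<close>, whose openers and closers encode it.\<close>
  then obtain \<pi>\<^sub>0 where \<pi>\<^sub>0: "\<pi>\<^sub>0 \<in> ordered_partitions n k" "t = partition_type \<pi>\<^sub>0"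
    by (auto simp: ordered_partitions_of_type_def)
  define P Q where "P = openers \<pi>\<^sub>0" and "Q = closers \<pi>\<^sub>0"
  let ?A = "ordered_partitions_of_type n k t"
  have A: "?A = states P Q (Suc n) n"
    unfolding \<pi>\<^sub>0(2) P_def Q_def by (rule ordered_partitions_of_type_eq_states[OF \<pi>\<^sub>0(1)])
  obtain \<sigma> where \<sigma>: "bij_betw \<sigma> ?A ?A"
      "\<And>\<pi>. \<pi> \<in> ?A \<Longrightarrow> rsb \<pi> + bMaj \<pi> = rsb (\<sigma> \<pi>) + bInv (\<sigma> \<pi>)"
    using states_bijection[of n "Suc n" P Q] unfolding A by blast
  let ?c = "\<Sum>i=1..n. card {j \<in> Q. j < i}" and ?o = "\<Sum>i=1..n. card {j \<in> P. i < j}"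
    and ?o' = "\<Sum>i=1..n. card {j \<in> P. j \<le> i}"
  have stats: "length \<pi> = k" "MAK \<pi> = ?c + rsb \<pi>" "MAK' \<pi> = ?o + rsb \<pi>"
      "lsb \<pi> + rsb \<pi> + ?c + n = ?o'" if "\<pi> \<in> ?A" for \<pi>
  proof -
    have \<pi>: "\<pi> \<in> ordered_partitions n k" "openers \<pi> = P" "closers \<pi> = Q"
      using that partition_type_eq_iff[OF _ \<pi>\<^sub>0(1)]
      by (auto simp: ordered_partitions_of_type_def \<pi>\<^sub>0(2) P_def Q_def)
    then show "length \<pi> = k" by (simp add: ordered_partitions_def)
    show "MAK \<pi> = ?c + rsb \<pi>" "MAK' \<pi> = ?o + rsb \<pi>" "lsb \<pi> + rsb \<pi> + ?c + n = ?o'"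
      using MAK_MAK'_lsb_conv_rsb[OF \<pi>(1)] unfolding \<pi>(2,3) by simp_all
  qed
  show ?thesis
  proof (rule equidistributed_onI[OF \<sigma>(1)])
    fix \<pi> assume \<pi>: "\<pi> \<in> ?A"
    then have "\<sigma> \<pi> \<in> ?A" using \<sigma>(1) bij_betwE by blast
    note s = stats[OF \<pi>] and s' = stats[OF this]
    show "(MAK \<pi> + bMaj \<pi>, MAK' \<pi> + bMaj \<pi>, cmajLSB \<pi>) =
        (MAK (\<sigma> \<pi>) + bInv (\<sigma> \<pi>), MAK' (\<sigma> \<pi>) + bInv (\<sigma> \<pi>), cinvLSB (\<sigma> \<pi>))"
      unfolding cmajLSB_def cbMaj_def cinvLSB_def cbInv_def s(1-3) s'(1-3)
      using \<sigma>(2)[OF \<pi>] s(4) s'(4) by simp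
  qed
qed

end
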